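(* Let $\mathfrak{N}^\nu(t)$ be the number of individuals in a fractional Yule process at time $t>0$. Then the following equality in distribution holds: $$\mathfrak{N}^\nu(t)\overset{d}{=}\mathcal{N}(T_{2\nu}(t)),$$ where $\mathcal{N}(t)$ is a classical Yule process, $\nu\in(0,1]$, and $T_{2\nu}(t)$ is a random time whose distribution coincides with the solution $g(x,t)$ to the Cauchy problem $$\begin{cases}\dfrac{\partial^{2\nu}}{\partial t^{2\nu}}g(x,t)=\dfrac{\partial^2}{\partial x^2}g(x,t), & x>0,\\[4pt] \left.\dfrac{\partial}{\partial x}g(x,t)\right|_{x=0}=0,\\[4pt] g(x,0)=\delta(x),\end{cases}$$ with the initial condition $g_t(x,0)=0$ when $1/2<\nu\le 1$.
   Context: Both processes have the same rate $\lambda>0$ and a single initial progenitor. Classical Yule process with rate $\lambda$ and one progenitor: the linear pure birth process on $\{1,2,\dots\}$ with birth rate $\lambda k$ in state $k$, so that $\Pr\{\mathcal{N}(t)=k\mid\mathcal{N}(0)=1\}=e^{-\lambda t}(1-e^{-\lambda t})^{k-1}$, $k\ge1$. Fractional Yule process with rate $\lambda$: its state probabilities $\mathfrak{p}^\nu_k(t)=\Pr\{\mathfrak{N}^\nu(t)=k\mid \mathfrak{N}^\nu(0)=1\}$ solve $\frac{d^\nu}{dt^\nu}\mathfrak{p}^\nu_k(t)=-\lambda k\,\mathfrak{p}^\nu_k(t)+\lambda(k-1)\mathfrak{p}^\nu_{k-1}(t)$, $k\ge1$, with $\mathfrak{p}^\nu_1(0)=1$ and $\mathfrak{p}^\nu_k(0)=0$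 for $k>1$ (for $k=1$ the last term is zero). Here $\frac{d^\nu}{dt^\nu}$ is the Caputo derivative: $\frac{d^\nu}{dt^\nu}f(t)=\frac{1}{\Gamma(1-\nu)}\int_0^t\frac{f'(s)}{(t-s)^\nu}ds$ for $\nu\in(0,1)$ and $f'(t)$ for $\nu=1$. Explicitly, $$\mathfrak{p}^\nu_k(t)=\sum_{l=1}^k\binom{k-1}{l-1}(-1)^{l-1}E_{\nu,1}(-\lambda l t^\nu),\qquad E_{\alpha,\beta}(\tau)=\sum_{r\ge0}\frac{\tau^r}{\Gamma(\alpha r+\beta)}.$$ The time derivative of order $2\nu$ in the Cauchy problem is also in the Caputo sense (for order $\alpha\in(1,2)$: $\frac{1}{\Gamma(2-\alpha)}\int_0^t f''(s)(t-s)^{1-\alpha}ds$; for $\alpha=2$: $f''$), and $\delta$ is the Dirac delta at $0$, regarded as a unit mass on $[0,\infty)$. The solution in question is the probability law with time-Laplace transform $\int_0^\infty e^{-zt}\Pr\{T_{2\nu}(t)\in ds\}\,dt=z^{\nu-1}e^{-sz^\nu}ds$, $s>0$; for $\nu\in(0,1)$ it has density $t^{-\nu}W_{-\nu,1-\nu}(-t^{-\nu}s)$, $s>0$, where $W_{-\nu,1-\nu}(-\xi)=\sum_{r\ge0}\frac{(-\xi)^r}{r!\,\Gamma(1-\nu(r+1))}$ (with $1/\Gamma=0$ at the poles of $\Gamma$), and for $\nu=1$ it is the point mass at $t$. *)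

theory Defs
  imports "HOL-Probability.Probability"
begin

text \<open>
  With n the least integer at least the order \<open>\<alpha> > 0\<close>, the Caputo derivative is the ordinary
  n-th derivative if \<open>\<alpha> = n\<close>, and otherwise the Caputo integral of the n-th derivative. Functions live on \<open>{0..}\<close>; their values at negative
  arguments are irrelevant because \<open>deriv\<close> is only taken at positive points.
\<close>

definition caputo_deriv :: "real \<Rightarrow> (real \<Rightarrow> real) \<Rightarrow> real \<Rightarrow> real" where
  "caputo_deriv \<alpha> f t =
     (let n = nat \<lceil>\<alpha>\<rceil> in
      if \<alpha> = real n then (deriv ^^ n) f t
      else (1 / Gamma (real n - \<alpha>)) *
           (LBINT s:{0<..<t}. (deriv ^^ n) f s * (t - s) powr (real n - \<alpha> - 1)))"

text \<open>
  The regularity under which the formula above is meaningful. Continuity at 0 ties the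
  initial value of \<open>f\<close> to its values at positive times.
\<close>

definition caputo_differentiable :: "real \<Rightarrow> (real \<Rightarrow> real) \<Rightarrow> bool" where
  "caputo_differentiable \<alpha> f \<longleftrightarrow>
     (let n = nat \<lceil>\<alpha>\<rceil> in
      continuous_on {0..} f \<and>
      (\<forall>k<n. \<forall>t>0. (deriv ^^ k) f differentiable (at t)) \<and>
      (\<alpha> \<noteq> real n \<longrightarrow>
         (\<forall>t>0. set_integrable lborel {0<..<t}
                  (\<lambda>s. (deriv ^^ n) f s * (t - s) powr (real n - \<alpha> - 1)))))"

text \<open>
  A pure birth process with birth rates \<open>b k\<close> and initial state \<open>i\<close>: a time-homogeneous Markov
  chain in continuous time, with nondecreasing right-continuous paths, whose transition
  probabilities \<open>P j k h\<close> (from \<open>j\<close> to \<open>k\<close> in time \<open>h\<close>) have as derivative at \<open>h = 0\<close> the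
  generator that leads from \<open>k\<close> to \<open>k + 1\<close> at rate \<open>b k\<close>. The product formula for the
  finite-dimensional distributions is the Markov property. Right continuity refers to the
  discrete topology of \<open>nat\<close>.
\<close>

definition birth_generator :: "(nat \<Rightarrow> real) \<Rightarrow> nat \<Rightarrow> nat \<Rightarrow> real" where
  "birth_generator b j k = (if k = j then - b j else if k = Suc j then b j else 0)"

definition pure_birth_process ::
    "'a measure \<Rightarrow> (nat \<Rightarrow> real) \<Rightarrow> nat \<Rightarrow> (real \<Rightarrow> 'a \<Rightarrow> nat) \<Rightarrow> bool" where
  "pure_birth_process M b i N \<longleftrightarrow>
     prob_space M \<and>
     (\<forall>t\<ge>0. N t \<in> measurable M (count_space UNIV)) \<and>
     (\<forall>\<omega>\<in>space M. N 0 \<omega> = i \<and> mono_on {0..} (\<lambda>t. N t \<omega>) \<and>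
        (\<forall>t\<ge>0. continuous (at_right t) (\<lambda>s. N s \<omega>))) \<and>
     (\<exists>P :: nat \<Rightarrow> nat \<Rightarrow> real \<Rightarrow> real.
        (\<forall>j k. P j k 0 = (if j = k then 1 else 0)) \<and>
        (\<forall>j k. (P j k has_real_derivative birth_generator b j k) (at 0 within {0..})) \<and>
        (\<forall>(n::nat) (t :: nat \<Rightarrow> real) (k :: nat \<Rightarrow> nat).
           0 \<le> t 0 \<and> (\<forall>m<n. t m \<le> t (Suc m)) \<longrightarrow>
           measure M {\<omega> \<in> space M. \<forall>m\<le>n. N (t m) \<omega> = k m} =
             P i (k 0) (t 0) * (\<Prod>m<n. P (k m) (k (Suc m)) (t (Suc m) - t m))))"

definition yule_process :: "'a measure \<Rightarrow> real \<Rightarrow> (real \<Rightarrow> 'a \<Rightarrow> nat) \<Rightarrow> bool" where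
  "yule_process M lam N \<longleftrightarrow> pure_birth_process M (\<lambda>k. lam * real k) 1 N"

text \<open>For \<open>k = 1\<close> the last term of the equation vanishes.\<close>

definition fractional_yule_process ::
    "'a measure \<Rightarrow> real \<Rightarrow> real \<Rightarrow> (real \<Rightarrow> 'a \<Rightarrow> nat) \<Rightarrow> bool" where
  "fractional_yule_process M lam \<nu> X \<longleftrightarrow>
     prob_space M \<and>
     (\<forall>t\<ge>0. X t \<in> measurable M (count_space UNIV)) \<and>
     (\<forall>t\<ge>0. \<forall>\<omega>\<in>space M. 1 \<le> X t \<omega>) \<and>
     (let p = (\<lambda>k t. measure M {\<omega> \<in> space M. X t \<omega> = k}) in
        p 1 0 = 1 \<and> (\<forall>k>1. p k 0 = 0) \<and>
        (\<forall>k\<ge>1. caputo_differentiable \<nu> (p k) \<and>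
           (\<forall>t>0. caputo_deriv \<nu> (p k) t =
                    - lam * real k * p k t + lam * (real k - 1) * p (k - 1) t)))"

text \<open>Independence of the sigma-algebras generated by \<open>T\<close> and by the whole process \<open>N s\<close>, \<open>s \<ge> 0\<close>.\<close>

definition indep_of_process :: "'a measure \<Rightarrow> ('a \<Rightarrow> real) \<Rightarrow> (real \<Rightarrow> 'a \<Rightarrow> nat) \<Rightarrow> bool" where
  "indep_of_process M T N \<longleftrightarrow>
     prob_space.indep_set M
       (sets (vimage_algebra (space M) T borel))
       (sets (vimage_algebra (space M) (\<lambda>\<omega>. \<lambda>s\<in>{0..}. N s \<omega>)
                (Pi\<^sub>M {0..} (\<lambda>_. count_space UNIV))))"

text \<open>
  Test functions for the Neumann problem on the half line: restrictions to \<open>{0..}\<close> of compactly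
  supported twice continuously differentiable functions \<open>\<phi>\<close> with \<open>\<phi>'(0) = 0\<close>, but with
  \<open>\<phi>(0)\<close> unrestricted.
\<close>

definition neumann_test_function :: "(real \<Rightarrow> real) \<Rightarrow> bool" where
  "neumann_test_function \<phi> \<longleftrightarrow>
     (\<forall>x. \<phi> differentiable (at x)) \<and> (\<forall>x. deriv \<phi> differentiable (at x)) \<and>
     continuous_on UNIV (deriv (deriv \<phi>)) \<and>
     bounded {x. \<phi> x \<noteq> 0} \<and> deriv \<phi> 0 = 0"

text \<open>
  A family \<open>g t\<close> (\<open>t \<ge> 0\<close>) of probability laws on \<open>{0..}\<close> that solves the Cauchy problem of
  time order \<open>\<alpha>\<close>. The problem is understood weakly in the space variable. Integrating
  \<open>\<phi> \<partial>\<^sup>2g/\<partial>x\<^sup>2\<close> by parts twice over the half line leaves the integral of \<open>\<phi>'' g\<close> and the boundary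
  terms \<open>- \<phi>(0) \<partial>g/\<partial>x(0) + \<phi>'(0) g(0)\<close>. The second one is 0 by the choice of test functions; the
  Neumann condition is that the first one is absent for arbitrary \<open>\<phi>(0)\<close>.

  A pointwise reading is not available. For \<open>\<alpha> = 2\<close> the solution is the point mass at \<open>t\<close>. For
  \<open>\<alpha> = 2\<nu> < 2\<close>, \<open>\<alpha> \<noteq> 1\<close>, the density \<open>t\<^sup>-\<^sup>\<nu> W(- t\<^sup>-\<^sup>\<nu> x)\<close> has the nonzero one-sided derivative
  \<open>- t\<^sup>-\<^sup>2\<^sup>\<nu> / \<Gamma>(1 - 2\<nu>)\<close> at \<open>x = 0\<close>, which the contribution of the initial unit mass at 0 to the
  Caputo derivative compensates.
\<close>

definition cauchy_problem_law :: "real \<Rightarrow> (real \<Rightarrow> real measure) \<Rightarrow> bool" where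
  "cauchy_problem_law \<alpha> g \<longleftrightarrow>
     (\<forall>t\<ge>0. prob_space (g t) \<and> sets (g t) = sets borel \<and> emeasure (g t) {..<0} = 0) \<and>
     g 0 = return borel 0 \<and>
     (\<forall>\<phi>. neumann_test_function \<phi> \<longrightarrow>
        (let F = (\<lambda>t. LINT x|g t. \<phi> x) in
           caputo_differentiable \<alpha> F \<and>
           (\<forall>t>0. caputo_deriv \<alpha> F t = (LINT x|g t. deriv (deriv \<phi>) x)) \<and>
           (1 < \<alpha> \<longrightarrow> (F has_real_derivative 0) (at 0 within {0..}))))"

end

theory Submission
  imports Defs "HOL-Real_Asymp.Real_Asymp"
begin

text \<open>
  Replacing time \<open>t\<close> by an exponential time of rate \<open>z\<close>, that is, taking Laplace transforms in \<open>t\<close>,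
  turns everything into algebra in \<open>a = z powr \<nu>\<close>.

  The Cauchy problem of order \<open>2 \<nu>\<close> says that the average \<open>U\<close> of the laws \<open>g\<^sub>t\<close> satisfies
  \<open>\<integral> (a\<^sup>2 \<phi> - \<phi>'') dU = a\<^sup>2 \<phi>(0)\<close> whenever \<open>\<phi>'(0) = 0\<close>. The left side involves the operator
  \<open>a\<^sup>2 - D\<^sup>2\<close> with \<open>D = d/dx\<close>, which factors as \<open>(a - D) (a + D)\<close>. For any
  \<open>\<psi>\<close> the first-order equation \<open>(a + D) \<phi> = \<psi>\<close> has a solution with \<open>\<phi>'(0) = 0\<close>, and it has
  \<open>\<phi>(0) = \<psi>(0) / a\<close>; therefore \<open>\<integral> (a \<psi> - \<psi>') dU = a \<psi>(0)\<close> for all bounded \<open>\<psi>\<close> with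
  bounded derivative (\<open>integral_exp_law_resolvent\<close>). This is the transform of an equation of order \<open>\<nu>\<close> in time and order 1
  in space: \<open>U\<close> is exponential of rate \<open>a\<close>.

  Apply it to the state probabilities \<open>P(k)\<close> of the classical Yule process, where the forward equation
  expresses \<open>P(k)'\<close> through \<open>P(k)\<close> and \<open>P(k - 1)\<close>. The result is a recursion for the transforms of
  \<open>\<integral> P(k) dg\<^sub>t\<close>, and it is the recursion that the Caputo equations give for the fractional Yule process
  (\<open>fractional_yule_prob_eq\<close>). Since both families are bounded and continuous in \<open>t\<close>, uniqueness of the
  Laplace transform (\<open>exp_law_integral_unique\<close>) identifies them.

  Three points need care. The derivatives inside the Caputo operators are only known to be locally
  integrable, with no control at infinity; so the equations are first inverted into Volterra equations
  (\<open>caputo_inversion\<close>), whose transforms converge absolutely. The weak formulation controls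
  \<open>t \<mapsto> \<integral> \<phi> dg\<^sub>t\<close> only for compactly supported Neumann test functions; approximation extends the
  transformed equation and continuity in \<open>t\<close> to the functions that are used
  (\<open>integral_exp_law_neumann\<close>, \<open>continuous_on_integral_cauchy_problem_law\<close>). Finally, that the law of
  \<open>N(T)\<close> is the mixture of the marginals of \<open>N\<close> under the law of \<open>T\<close> rests on right continuity of the
  paths (\<open>subordinated_process_prob\<close>).
\<close>

section \<open>Fractional integrals\<close>

text \<open>
  The Riemann--Liouville integral of order \<open>a\<close>. A Caputo derivative whose order \<open>\<alpha>\<close> is not an
  integer is this integral, of order \<open>n - \<alpha>\<close>, of the \<open>n\<close>-th derivative.
\<close>

definition frac_int :: "real \<Rightarrow> (real \<Rightarrow> real) \<Rightarrow> real \<Rightarrow> real" where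
  "frac_int a f t = (LBINT s:{0<..<t}. f s * (t - s) powr (a - 1)) / Gamma a"

text \<open>
  Euler's integral, moved from the unit interval to \<open>{s<..<t}\<close> by \<open>u = s + (t - s) x\<close>: the composition
  of two Riemann--Liouville kernels is a multiple of such a kernel.
\<close>

lemma has_bochner_integral_Beta_interval:
  fixes a b s t :: real
  assumes "a > 0" "b > 0" "s < t"
  shows "has_bochner_integral lborel
           (\<lambda>u. indicator {s<..<t} u * ((t - u) powr (a - 1) * (u - s) powr (b - 1)))
           ((t - s) powr (a + b - 1) * Beta a b)"
proof -
  have B: "has_bochner_integral lborel
             (\<lambda>x. indicator {0..1} x *\<^sub>R (x powr (b - 1) * (1 - x) powr (a - 1))) (Beta b a)"
    using integrable_Beta[of b a] assms integral_unique[OF has_integral_Beta_real[of b a]]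
      set_borel_integral_eq_integral(2)[OF integrable_Beta[of b a]]
    by (simp add: has_bochner_integral_iff set_integrable_def set_lebesgue_integral_def)
  have "has_bochner_integral lborel
          (\<lambda>x. (t - s) powr (a + b - 2) * (indicator {0..1} x *\<^sub>R (x powr (b - 1) * (1 - x) powr (a - 1))))
          ((t - s) powr (a + b - 2) * Beta b a)"
    by (intro has_bochner_integral_mult_right B)
  also have "(\<lambda>x. (t - s) powr (a + b - 2) * (indicator {0..1} x *\<^sub>R (x powr (b - 1) * (1 - x) powr (a - 1)))) =
     (\<lambda>x. indicator {s<..<t} (s + (t - s) * x) *
        ((t - (s + (t - s) * x)) powr (a - 1) * ((s + (t - s) * x) - s) powr (b - 1)))"
  proof
    fix x :: real
    have *: "s + (t - s) * x \<in> {s<..<t} \<longleftrightarrow> 0 < x \<and> x < 1"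
    proof -
      have "(t - s) * x < t - s \<longleftrightarrow> x < 1"
        using mult_less_cancel_left_pos[of "t - s" x 1] assms by simp
      moreover have "s + (t - s) * x < t \<longleftrightarrow> (t - s) * x < t - s" by linarith
      ultimately show ?thesis using assms by (simp add: zero_less_mult_iff)
    qed
    show "(t - s) powr (a + b - 2) * (indicator {0..1} x *\<^sub>R (x powr (b - 1) * (1 - x) powr (a - 1))) =
       indicator {s<..<t} (s + (t - s) * x) *
        ((t - (s + (t - s) * x)) powr (a - 1) * ((s + (t - s) * x) - s) powr (b - 1))"
    proof (cases "0 < x \<and> x < 1")
      case True
      have "t - (s + (t - s) * x) = (t - s) * (1 - x)" by (simp add: algebra_simps)
      then have "(t - (s + (t - s) * x)) powr (a - 1) = (t - s) powr (a - 1) * (1 - x) powr (a - 1)"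
        using True assms by (simp add: powr_mult)
      moreover have "((s + (t - s) * x) - s) powr (b - 1) = (t - s) powr (b - 1) * x powr (b - 1)"
        using True assms by (simp add: powr_mult)
      moreover have "(t - s) powr (a + b - 2) = (t - s) powr (a - 1) * (t - s) powr (b - 1)"
        by (simp add: powr_add[symmetric] algebra_simps)
      ultimately show ?thesis using True * by simp
    next
      case False
      with * show ?thesis by (auto simp: indicator_def)
    qed
  qed
  also have "(t - s) powr (a + b - 2) * Beta b a = ((t - s) powr (a + b - 1) * Beta a b) /\<^sub>R \<bar>t - s\<bar>"
  proof -
    have "(t - s) powr (a + b - 1) = (t - s) powr (a + b - 2) * (t - s)"
      using assms powr_add[of "t - s" "a + b - 2" 1] by (simp add: algebra_simps)
    then have "(t - s) powr (a + b - 1) * Beta a b / (t - s) = (t - s) powr (a + b - 2) * Beta a b"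
      using assms by simp
    then show ?thesis using assms by (auto simp: Beta_commute[of b] divide_inverse mult_ac)
  qed
  finally show ?thesis
    using lborel_has_bochner_integral_real_affine_iff[of "t - s" "\<lambda>u. indicator {s<..<t} u * ((t - u) powr (a - 1) * (u - s) powr (b - 1))" _ s] assms
    by simp
qed

text \<open>
  The Laplace transform of a Riemann--Liouville kernel that starts at \<open>s\<close>; the substitution
  \<open>t = s + x / z\<close> turns it into the Gamma integral.
\<close>

lemma has_bochner_integral_Gamma_shift:
  fixes a s z :: real
  assumes "a > 0" "z > 0"
  shows "has_bochner_integral lborel
           (\<lambda>t. indicator {s<..} t * (exp (- z * t) * (t - s) powr (a - 1)))
           (exp (- z * s) * Gamma a / z powr a)"
proof -
  have B: "has_bochner_integral lborel (\<lambda>x. indicator {0..} x * (x powr (a - 1) / exp x)) (Gamma a)"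
  proof (rule has_bochner_integral_nn_integral)
    show "(\<integral>\<^sup>+ x. ennreal (indicator {0..} x * (x powr (a - 1) / exp x)) \<partial>lborel) = ennreal (Gamma a)"
      using nn_integral_has_integral_lebesgue[OF _ Gamma_integral_real[OF assms(1)]] by simp
    show "0 \<le> Gamma a" using Gamma_real_pos[OF assms(1)] by simp
  qed (auto intro!: AE_I2)
  have "has_bochner_integral lborel
          (\<lambda>x. exp (- z * s) / z powr (a - 1) * (indicator {0..} x * (x powr (a - 1) / exp x)))
          (exp (- z * s) / z powr (a - 1) * Gamma a)"
    by (intro has_bochner_integral_mult_right B)
  also have "(\<lambda>x. exp (- z * s) / z powr (a - 1) * (indicator {0..} x * (x powr (a - 1) / exp x))) =
     (\<lambda>x. indicator {s<..} (s + (1 / z) * x) *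
        (exp (- z * (s + (1 / z) * x)) * ((s + (1 / z) * x) - s) powr (a - 1)))"
  proof
    fix x :: real
    have "exp (- z * (s + 1 / z * x)) = exp (- z * s) / exp x"
      using assms by (simp add: algebra_simps exp_diff[symmetric])
    then show "exp (- z * s) / z powr (a - 1) * (indicator {0..} x * (x powr (a - 1) / exp x)) =
       indicator {s<..} (s + (1 / z) * x) *
        (exp (- z * (s + (1 / z) * x)) * ((s + (1 / z) * x) - s) powr (a - 1))"
      using assms by (auto simp: indicator_def powr_divide zero_less_divide_iff)
  qed
  also have "exp (- z * s) / z powr (a - 1) * Gamma a = (exp (- z * s) * Gamma a / z powr a) /\<^sub>R \<bar>1 / z\<bar>"
    using assms by (simp add: powr_diff field_simps)
  finally show ?thesis
    using lborel_has_bochner_integral_real_affine_iff[of "1 / z" "\<lambda>t. indicator {s<..} t * (exp (- z * t) * (t - s) powr (a - 1))" _ s] assms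
    by simp
qed

text \<open>
  Fubini's theorem for a nonnegative kernel. Because \<open>k\<close> keeps its sign, integrability of the product
  on the plane only has to be known for the iterated integral in which the mass \<open>K s\<close> of \<open>k s\<close> is
  explicit. Both the composition of fractional integrals and their Laplace transform are instances.
\<close>

lemma integral_nonneg_kernel_swap:
  fixes f K :: "real \<Rightarrow> real" and k :: "real \<Rightarrow> real \<Rightarrow> real"
  assumes k: "case_prod k \<in> borel_measurable (borel \<Otimes>\<^sub>M borel)" and nonneg: "\<And>s u. 0 \<le> k s u"
    and f: "f \<in> borel_measurable borel"
    and K: "\<And>s. f s \<noteq> 0 \<Longrightarrow> has_bochner_integral lborel (k s) (K s)"
    and fK: "integrable lborel (\<lambda>s. f s * K s)"
  shows "(LINT u|lborel. LINT s|lborel. f s * k s u) = (LINT s|lborel. f s * K s)"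
proof -
  note [measurable] = k f
  have in1: "integrable lborel (\<lambda>u. f s * k s u)" for s
    using K[of s] by (cases "f s = 0") (auto intro: has_bochner_integral_mult_right integrable.intros)
  have in2: "(LINT u|lborel. f s * k s u) = f s * K s" for s
    using K[of s] by (cases "f s = 0") (auto dest: has_bochner_integral_integral_eq)
  have Kn: "0 \<le> K s" if "f s \<noteq> 0" for s
    using has_bochner_integral_integral_eq[OF K[OF that]] nonneg
      Bochner_Integration.integral_nonneg[of lborel "k s"] by simp
  have nrm: "(LINT u|lborel. norm (f s * k s u)) = norm (f s * K s)" for s
  proof -
    have "(LINT u|lborel. norm (f s * k s u)) = (LINT u|lborel. \<bar>f s\<bar> * k s u)"
      using nonneg by (simp add: abs_mult)
    also have "\<dots> = \<bar>f s\<bar> * K s"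
      using K[of s] by (cases "f s = 0") (auto dest: has_bochner_integral_integral_eq)
    also have "\<dots> = norm (f s * K s)"
      using Kn[of s] by (cases "f s = 0") (auto simp: abs_mult)
    finally show ?thesis .
  qed
  have "integrable (lborel \<Otimes>\<^sub>M lborel) (\<lambda>(s, u). f s * k s u)"
  proof (rule lborel_pair.Fubini_integrable)
    show "(\<lambda>(s, u). f s * k s u) \<in> borel_measurable (lborel \<Otimes>\<^sub>M lborel)"
      by simp
    show "integrable lborel (\<lambda>x. \<integral> y. norm (case (x, y) of (s, u) \<Rightarrow> f s * k s u) \<partial>lborel)"
      using integrable_norm[OF fK] by (simp only: nrm prod.case)
    show "AE x in lborel. integrable lborel (\<lambda>y. case (x, y) of (s, u) \<Rightarrow> f s * k s u)"
      using in1 by simp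
  qed
  from lborel_pair.Fubini_integral[OF this] show ?thesis
    by (simp only: in2 prod.case)
qed

text \<open>
  Exchanging the integrals leaves the Beta integral of the two kernels. The condition \<open>a + b \<ge> 1\<close> makes
  the composed kernel bounded on \<open>{0<..<t}\<close>, so that integrability of \<open>f\<close> alone gives absolute
  convergence; at a smaller order \<open>f\<close> could be too singular close to \<open>t\<close>.
\<close>

lemma frac_int_semigroup:
  fixes f :: "real \<Rightarrow> real"
  assumes a: "a > 0" and b: "b > 0" and ab: "a + b \<ge> 1"
    and f: "set_integrable lborel {0<..<t} f"
  shows "frac_int a (frac_int b f) t = frac_int (a + b) f t"
proof -
  define f' where "f' = (\<lambda>s. indicator {0<..<t} s * f s)"
  have f'i: "integrable lborel f'"
    using f by (simp add: set_integrable_def f'_def)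
  then have [measurable]: "f' \<in> borel_measurable borel" by auto
  define k where "k = (\<lambda>s u. indicator {s<..<t} u * ((t - u) powr (a - 1) * (u - s) powr (b - 1)))"
  have km: "case_prod k \<in> borel_measurable (borel \<Otimes>\<^sub>M borel)"
  proof -
    have "case_prod k = (\<lambda>(s, u). (if s < u \<and> u < t then 1 else 0) * ((t - u) powr (a - 1) * (u - s) powr (b - 1)))"
      by (auto simp: k_def fun_eq_iff)
    then show ?thesis by simp
  qed
  define K where "K = (\<lambda>s. indicator {0<..<t} s * ((t - s) powr (a + b - 1) * Beta a b))"
  have Kb: "\<bar>K s\<bar> \<le> t powr (a + b - 1) * \<bar>Beta a b\<bar>" for s
    using ab by (auto simp: K_def abs_mult indicator_def intro!: mult_right_mono powr_mono2)
  have fK: "integrable lborel (\<lambda>s. f' s * K s)"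
  proof (rule Bochner_Integration.integrable_bound)
    show "integrable lborel (\<lambda>s. (t powr (a + b - 1) * \<bar>Beta a b\<bar>) * f' s)"
      using f'i by simp
    show "(\<lambda>s. f' s * K s) \<in> borel_measurable lborel"
      unfolding K_def by measurable
    show "AE s in lborel. norm (f' s * K s) \<le> norm (t powr (a + b - 1) * \<bar>Beta a b\<bar> * f' s)"
    proof (rule AE_I2)
      fix s
      have "\<bar>f' s\<bar> * \<bar>K s\<bar> \<le> \<bar>f' s\<bar> * (t powr (a + b - 1) * \<bar>Beta a b\<bar>)"
        by (intro mult_left_mono Kb) auto
      then show "norm (f' s * K s) \<le> norm (t powr (a + b - 1) * \<bar>Beta a b\<bar> * f' s)"
        by (simp add: abs_mult mult_ac)
    qed
  qed
  have "(LINT u|lborel. LINT s|lborel. f' s * k s u) = (LINT s|lborel. f' s * K s)"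
  proof (rule integral_nonneg_kernel_swap[OF km _ _ _ fK])
    show "has_bochner_integral lborel (k s) (K s)" if "f' s \<noteq> 0" for s
      using that has_bochner_integral_Beta_interval[of a b s t] a b
      by (auto simp: f'_def k_def K_def indicator_def)
  qed (auto simp: k_def)
  also have "(LINT s|lborel. f' s * K s) = Beta a b * Gamma (a + b) * frac_int (a + b) f t"
  proof -
    have "(LINT s|lborel. f' s * K s) =
        (LINT s|lborel. Beta a b * (indicator {0<..<t} s *\<^sub>R (f s * (t - s) powr (a + b - 1))))"
      by (intro Bochner_Integration.integral_cong) (auto simp: f'_def K_def indicator_def)
    moreover have "Gamma (a + b) \<noteq> 0" using a b Gamma_real_pos[of "a + b"] by linarith
    ultimately show ?thesis
      by (simp add: frac_int_def set_lebesgue_integral_def)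
  qed
  also have "(LINT u|lborel. LINT s|lborel. f' s * k s u) =
      (LINT u|lborel. Gamma b * (indicator {0<..<t} u *\<^sub>R (frac_int b f u * (t - u) powr (a - 1))))"
  proof (intro Bochner_Integration.integral_cong refl)
    fix u
    show "(LINT s|lborel. f' s * k s u) = Gamma b * (indicator {0<..<t} u *\<^sub>R (frac_int b f u * (t - u) powr (a - 1)))"
    proof (cases "0 < u \<and> u < t")
      case True
      have "(LINT s|lborel. f' s * k s u) =
         (LINT s|lborel. (t - u) powr (a - 1) * (indicator {0<..<u} s *\<^sub>R (f s * (u - s) powr (b - 1))))"
        using True by (intro Bochner_Integration.integral_cong) (auto simp: f'_def k_def indicator_def)
      moreover have "Gamma b \<noteq> 0" using b Gamma_real_pos[of b] by linarith
      ultimately show ?thesis using True by (simp add: frac_int_def set_lebesgue_integral_def)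
    next
      case False
      then have "(\<lambda>s. f' s * k s u) = (\<lambda>s. 0)" by (auto simp: f'_def k_def indicator_def)
      then show ?thesis using False by (auto simp: indicator_def)
    qed
  qed
  also have "\<dots> = Gamma b * Gamma a * frac_int a (frac_int b f) t"
  proof -
    have "Gamma a \<noteq> 0" using a Gamma_real_pos[of a] by linarith
    then show ?thesis by (simp add: frac_int_def set_lebesgue_integral_def)
  qed
  finally have "Gamma b * Gamma a * frac_int a (frac_int b f) t =
    Beta a b * Gamma (a + b) * frac_int (a + b) f t" .
  moreover have "Gamma a \<noteq> 0" "Gamma b \<noteq> 0" "Gamma (a + b) \<noteq> 0"
    using a b Gamma_real_pos[of a] Gamma_real_pos[of b] Gamma_real_pos[of "a + b"] by linarith+
  moreover from this have "Beta a b * Gamma (a + b) = Gamma b * Gamma a"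
    by (simp add: Beta_def)
  ultimately show ?thesis
    by simp
qed

lemma borel_measurable_frac_int:
  assumes [measurable]: "f \<in> borel_measurable borel"
  shows "frac_int a f \<in> borel_measurable borel"
proof -
  have "frac_int a f = (\<lambda>t. (LINT s|lborel. (if 0 < s \<and> s < t then 1 else 0) * (f s * (t - s) powr (a - 1))) / Gamma a)"
    by (auto simp: frac_int_def set_lebesgue_integral_def fun_eq_iff indicator_def
         intro!: arg_cong2[where f="(/)"] Bochner_Integration.integral_cong)
  then show ?thesis by simp
qed

lemma frac_int_cong:
  assumes "\<And>s. 0 < s \<Longrightarrow> s < t \<Longrightarrow> f s = g s"
  shows "frac_int a f t = frac_int a g t"
  unfolding frac_int_def set_lebesgue_integral_def
  using assms by (auto intro!: arg_cong2[where f="(/)"] Bochner_Integration.integral_cong simp: indicator_def)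

section \<open>Caputo equations as Volterra equations\<close>

text \<open>
  The fundamental theorem of calculus for a function that need not be differentiable, nor even
  continuous, at the left end point: the value there is a limit \<open>c\<close> along one sequence of points. The
  derivative exists in the rest of the interval and is Lebesgue integrable, but it may be discontinuous;
  for this reason the proof passes through the Henstock--Kurzweil integral.
\<close>

lemma integral_deriv_open_interval:
  fixes H H' :: "real \<Rightarrow> real"
  assumes t: "0 < t" and H: "\<And>s. 0 < s \<Longrightarrow> s \<le> t \<Longrightarrow> (H has_real_derivative H' s) (at s)"
    and int: "set_integrable lborel {0<..<t} H'"
    and \<xi>: "\<xi> \<longlonglongrightarrow> 0" "\<And>n. 0 < \<xi> n" "\<And>n::nat. \<xi> n < t" and c: "(\<lambda>n. H (\<xi> n)) \<longlonglongrightarrow> c"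
  shows "(LBINT s:{0<..<t}. H' s) = H t - c"
proof -
  have step: "(LBINT s:{\<xi> n<..<t}. H' s) = H t - H (\<xi> n)" for n
  proof -
    have "(H' has_integral H t - H (\<xi> n)) {\<xi> n..t}"
    proof (rule fundamental_theorem_of_calculus)
      show "\<xi> n \<le> t" using \<xi>(3)[of n] by simp
      show "(H has_vector_derivative H' x) (at x within {\<xi> n..t})" if "x \<in> {\<xi> n..t}" for x
        using H[of x] \<xi>(2)[of n] that
        by (auto simp: has_real_derivative_iff_has_vector_derivative intro: has_vector_derivative_at_within)
    qed
    then have "(H' has_integral H t - H (\<xi> n)) {\<xi> n<..<t}"
      by (simp add: has_integral_Icc_iff_Ioo)
    moreover have "set_integrable lborel {\<xi> n<..<t} H'"
      by (rule set_integrable_subset[OF int]) (use \<xi>(2)[of n] in auto)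
    ultimately show ?thesis
      using set_borel_integral_eq_integral(2) integral_unique by metis
  qed
  have "(\<lambda>n. LBINT s:{\<xi> n<..<t}. H' s) \<longlonglongrightarrow> (LBINT s:{0<..<t}. H' s)"
    unfolding set_lebesgue_integral_def
  proof (rule integral_dominated_convergence[where w = "\<lambda>s. norm (indicator {0<..<t} s *\<^sub>R H' s)"])
    show m: "(\<lambda>s. indicator {0<..<t} s *\<^sub>R H' s) \<in> borel_measurable lborel"
      using int by (auto simp: set_integrable_def)
    show "integrable lborel (\<lambda>s. norm (indicator {0<..<t} s *\<^sub>R H' s))"
      using int unfolding set_integrable_def by (rule integrable_norm)
    show "(\<lambda>s. indicator {\<xi> n<..<t} s *\<^sub>R H' s) \<in> borel_measurable lborel" for n
      using set_integrable_subset[OF int, of "{\<xi> n<..<t}"] \<xi>(2)[of n] by (force simp: set_integrable_def)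
    show "AE s in lborel. norm (indicator {\<xi> n<..<t} s *\<^sub>R H' s) \<le> norm (indicator {0<..<t} s *\<^sub>R H' s)" for n
      using \<xi>(2)[of n] by (intro AE_I2) (auto simp: indicator_def)
    show "AE s in lborel. (\<lambda>n. indicator {\<xi> n<..<t} s *\<^sub>R H' s) \<longlonglongrightarrow> indicator {0<..<t} s *\<^sub>R H' s"
    proof (rule AE_I2, rule tendsto_eventually)
      fix s
      show "\<forall>\<^sub>F n in sequentially. indicator {\<xi> n<..<t} s *\<^sub>R H' s = indicator {0<..<t} s *\<^sub>R H' s"
      proof (cases "0 < s")
        case True
        have "\<forall>\<^sub>F n in sequentially. \<xi> n < s" by (rule order_tendstoD(2)[OF \<xi>(1) True])
        then show ?thesis by eventually_elim (use True in \<open>auto simp: indicator_def\<close>)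
      next
        case False
        have "indicator {\<xi> n<..<t} s *\<^sub>R H' s = indicator {0<..<t} s *\<^sub>R H' s" for n
          using False \<xi>(2)[of n] by (auto simp: indicator_def)
        then show ?thesis by simp
      qed
    qed
  qed
  moreover have "(\<lambda>n. LBINT s:{\<xi> n<..<t}. H' s) \<longlonglongrightarrow> H t - c"
    unfolding step by (intro tendsto_intros c)
  ultimately show ?thesis by (rule LIMSEQ_unique)
qed

lemma frac_int_deriv:
  fixes F :: "real \<Rightarrow> real"
  assumes t: "0 < t" and F: "continuous_on {0..} F" "\<And>s. 0 < s \<Longrightarrow> F differentiable (at s)"
    and int: "set_integrable lborel {0<..<t} (deriv F)"
  shows "frac_int 1 (deriv F) t = F t - F 0"
proof -
  define \<xi> where "\<xi> n = t / real (n + 2)" for n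
  have \<xi>: "\<xi> \<longlonglongrightarrow> 0" "0 < \<xi> n" "\<xi> n < t" for n
    unfolding \<xi>_def using t by (real_asymp, auto simp: field_simps add_pos_nonneg)
  have "(\<lambda>n. F (\<xi> n)) \<longlonglongrightarrow> F 0"
    using \<xi> by (intro continuous_on_tendsto_compose[OF F(1)]) (auto intro!: always_eventually less_imp_le)
  then have "(LBINT s:{0<..<t}. deriv F s) = F t - F 0"
    using F(2) by (intro integral_deriv_open_interval[OF t _ int \<xi>])
      (auto simp: DERIV_deriv_iff_real_differentiable)
  moreover have "(LBINT s:{0<..<t}. deriv F s * (t - s) powr (1 - 1)) = (LBINT s:{0<..<t}. deriv F s)"
    by (intro set_lebesgue_integral_cong) auto
  ultimately show ?thesis by (simp add: frac_int_def)
qed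

text \<open>
  Taylor's formula with integral remainder: \<open>(t - s) F'(s) + F(s)\<close> has the derivative
  \<open>(t - s) F''(s)\<close>. Nothing bounds \<open>F'\<close> close to 0 in advance, but the mean value theorem turns the
  one-sided derivative 0 of \<open>F\<close> at 0 into points \<open>\<xi> n\<close> that tend to 0 with \<open>F'(\<xi> n)\<close> tending to 0,
  and such a sequence suffices.
\<close>

lemma frac_int_deriv_deriv:
  fixes F :: "real \<Rightarrow> real"
  assumes t: "0 < t" and F: "continuous_on {0..} F" "\<And>s. 0 < s \<Longrightarrow> F differentiable (at s)"
    and F': "\<And>s. 0 < s \<Longrightarrow> deriv F differentiable (at s)"
    and F0: "(F has_real_derivative 0) (at 0 within {0..})"
    and int: "set_integrable lborel {0<..<t} (deriv (deriv F))"
  shows "frac_int 2 (deriv (deriv F)) t = F t - F 0"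
proof -
  define x where "x n = t / real (n + 2)" for n
  have x: "x \<longlonglongrightarrow> 0" "0 < x n" "x n < t" for n
    unfolding x_def using t by (real_asymp, auto simp: field_simps add_pos_nonneg)
  have "\<exists>\<xi>. 0 < \<xi> \<and> \<xi> < x n \<and> F (x n) - F 0 = x n * deriv F \<xi>" for n
  proof -
    obtain l \<xi> where "0 < \<xi>" "\<xi> < x n" "DERIV F \<xi> :> l" "F (x n) - F 0 = (x n - 0) * l"
      using MVT[of 0 "x n" F] x(2)[of n] F(2) continuous_on_subset[OF F(1), of "{0..x n}"] by auto
    then show ?thesis by (auto dest: DERIV_imp_deriv)
  qed
  then obtain \<xi> where \<xi>: "\<And>n. 0 < \<xi> n" "\<And>n. \<xi> n < x n" "\<And>n. F (x n) - F 0 = x n * deriv F (\<xi> n)"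
    by metis
  have \<xi>t: "\<xi> n < t" for n using \<xi>(2)[of n] x(3)[of n] by linarith
  have \<xi>0: "\<xi> \<longlonglongrightarrow> 0"
    by (rule tendsto_sandwich[OF _ _ tendsto_const x(1)]) (use \<xi> in \<open>auto intro!: always_eventually less_imp_le\<close>)
  have "((\<lambda>y. (F y - F 0) / (y - 0)) \<longlongrightarrow> 0) (at 0 within {0..})"
    using F0 by (simp add: has_field_derivative_iff)
  then have "(\<lambda>n. (F (x n) - F 0) / (x n - 0)) \<longlonglongrightarrow> 0"
    by (rule filterlim_compose) (use x in \<open>auto simp: filterlim_at less_imp_le less_imp_neq[THEN not_sym] intro!: always_eventually\<close>)
  moreover have "(F (x n) - F 0) / (x n - 0) = deriv F (\<xi> n)" for n
    using \<xi>(3)[of n] x(2)[of n] by (simp add: field_simps)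
  ultimately have d0: "(\<lambda>n. deriv F (\<xi> n)) \<longlonglongrightarrow> 0" by simp
  have "(\<lambda>n. F (\<xi> n)) \<longlonglongrightarrow> F 0"
    using \<xi>0 \<xi>(1) by (intro continuous_on_tendsto_compose[OF F(1)]) (auto intro!: always_eventually less_imp_le)
  then have c: "(\<lambda>n. (t - \<xi> n) * deriv F (\<xi> n) + F (\<xi> n)) \<longlonglongrightarrow> (t - 0) * 0 + F 0"
    by (intro tendsto_intros \<xi>0 d0)
  have "(LBINT s:{0<..<t}. (t - s) * deriv (deriv F) s) = ((t - t) * deriv F t + F t) - ((t - 0) * 0 + F 0)"
  proof (rule integral_deriv_open_interval[OF t _ _ \<xi>0 \<xi>(1) \<xi>t c])
    fix s :: real assume "0 < s"
    then have "(F has_real_derivative deriv F s) (at s)" "(deriv F has_real_derivative deriv (deriv F) s) (at s)"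
      using F(2) F' by (auto simp: DERIV_deriv_iff_real_differentiable)
    then show "((\<lambda>s. (t - s) * deriv F s + F s) has_real_derivative (t - s) * deriv (deriv F) s) (at s)"
      by (auto intro!: derivative_eq_intros)
  next
    show "set_integrable lborel {0<..<t} (\<lambda>s. (t - s) * deriv (deriv F) s)"
      unfolding set_integrable_def
    proof (rule Bochner_Integration.integrable_bound)
      show "integrable lborel (\<lambda>s. t *\<^sub>R (indicator {0<..<t} s *\<^sub>R deriv (deriv F) s))"
        using int unfolding set_integrable_def by (intro integrable_scaleR_right) auto
      have "(\<lambda>s. indicator {0<..<t} s *\<^sub>R deriv (deriv F) s) \<in> borel_measurable lborel"
        using int unfolding set_integrable_def by auto
      then have "(\<lambda>s. (t - s) *\<^sub>R (indicator {0<..<t} s *\<^sub>R deriv (deriv F) s)) \<in> borel_measurable lborel"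
        by measurable
      then show "(\<lambda>s. indicator {0<..<t} s *\<^sub>R ((t - s) * deriv (deriv F) s)) \<in> borel_measurable lborel"
        by (simp add: mult_ac)
    qed (auto intro!: AE_I2 mult_right_mono simp: indicator_def abs_mult)
  qed
  moreover have "(LBINT s:{0<..<t}. deriv (deriv F) s * (t - s) powr (2 - 1)) = (LBINT s:{0<..<t}. (t - s) * deriv (deriv F) s)"
    by (intro set_lebesgue_integral_cong) (auto simp: powr_one)
  moreover have "Gamma (2::real) = 1" using Gamma_fact[of 1, where 'a = real] by simp
  ultimately show ?thesis by (simp add: frac_int_def)
qed

lemma borel_measurable_deriv_half_line:
  fixes F :: "real \<Rightarrow> real"
  assumes F: "\<And>s. 0 < s \<Longrightarrow> F differentiable (at s)"
  shows "(deriv F) \<in> borel_measurable (restrict_space borel {0<..})"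
proof (rule borel_measurable_LIMSEQ_real)
  fix s :: real assume "s \<in> space (restrict_space borel {0<..})"
  then have s: "0 < s" by simp
  have "(F has_real_derivative deriv F s) (at s)"
    using F[OF s] by (simp add: DERIV_deriv_iff_real_differentiable)
  then have "((\<lambda>h. (F (s + h) - F s) / h) \<longlongrightarrow> deriv F s) (at 0)"
    by (simp add: DERIV_def)
  moreover have "filterlim (\<lambda>n. 1 / real (Suc n)) (at 0) sequentially"
    by (auto simp: filterlim_at intro!: always_eventually) real_asymp
  ultimately show "(\<lambda>n. (F (s + 1 / real (Suc n)) - F s) / (1 / real (Suc n))) \<longlonglongrightarrow> deriv F s"
    by (rule filterlim_compose)
next
  fix n :: nat
  have cF: "continuous_on {0<..} F"
    using F by (auto intro!: continuous_at_imp_continuous_on differentiable_imp_continuous_within)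
  have "continuous_on {0<..} (\<lambda>s. F (s + 1 / real (Suc n)))"
    by (rule continuous_on_compose2[OF cF]) (auto intro!: continuous_intros simp: add_pos_pos)
  then show "(\<lambda>s. (F (s + 1 / real (Suc n)) - F s) / (1 / real (Suc n))) \<in> borel_measurable (restrict_space borel {0<..})"
    using cF by (intro borel_measurable_continuous_on_restrict continuous_intros) auto
qed

lemma borel_measurable_half_line_iff:
  fixes f :: "real \<Rightarrow> real"
  shows "f \<in> borel_measurable (restrict_space borel {0<..}) \<longleftrightarrow> (\<lambda>s. indicator {0<..} s * f s) \<in> borel_measurable borel"
  by (subst borel_measurable_restrict_space_iff) auto

lemma frac_int_indicator: "frac_int a (\<lambda>s. indicator {0<..} s * f s) = frac_int a f"
  by (rule ext, rule frac_int_cong) auto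

text \<open>
  A Caputo equation is a Volterra equation. With \<open>n\<close> the least integer at least \<open>\<alpha>\<close>, the derivative
  of order \<open>\<alpha>\<close> is the fractional integral of order \<open>n - \<alpha>\<close> of the \<open>n\<close>-th derivative; integrating it with order \<open>\<alpha>\<close>
  gives the integral of order \<open>n\<close> by the semigroup property, and Taylor's formula evaluates that. (If
  \<open>\<alpha> = n\<close>, only the last step remains, and the bound on \<open>h\<close> makes the derivative integrable.) The
  Volterra form no longer involves derivatives of \<open>F\<close>, about whose growth in \<open>t\<close> nothing is known, and
  it also shows that \<open>h\<close> is measurable.
\<close>

lemma caputo_inversion:
  fixes F h :: "real \<Rightarrow> real"
  assumes \<alpha>: "0 < \<alpha>" "\<alpha> \<le> 2" and F: "caputo_differentiable \<alpha> F"
    and F0: "1 < \<alpha> \<Longrightarrow> (F has_real_derivative 0) (at 0 within {0..})"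
    and h: "\<And>t. 0 < t \<Longrightarrow> caputo_deriv \<alpha> F t = h t" and C: "\<And>t. 0 < t \<Longrightarrow> \<bar>h t\<bar> \<le> C"
  shows "h \<in> borel_measurable (restrict_space borel {0<..})"
    and "\<And>t. 0 < t \<Longrightarrow> F t = F 0 + frac_int \<alpha> h t"
proof -
  define n where "n = nat \<lceil>\<alpha>\<rceil>"
  define G where "G = (deriv ^^ n) F"
  have n: "n = 1 \<or> n = 2" "real n - 1 < \<alpha>" "\<alpha> \<le> real n"
    using \<alpha> unfolding n_def by linarith+
  have cF: "continuous_on {0..} F" and dF: "\<And>k s. k < n \<Longrightarrow> 0 < s \<Longrightarrow> (deriv ^^ k) F differentiable (at s)"
    and iF: "\<And>t. \<alpha> \<noteq> real n \<Longrightarrow> 0 < t \<Longrightarrow> set_integrable lborel {0<..<t} (\<lambda>s. G s * (t - s) powr (real n - \<alpha> - 1))"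
    using F unfolding caputo_differentiable_def Let_def n_def[symmetric] G_def by blast+
  have taylor: "frac_int (real n) G t = F t - F 0" if "0 < t" "set_integrable lborel {0<..<t} G" for t
    using n(1)
  proof
    assume "n = 1"
    then show ?thesis using frac_int_deriv[OF that(1) cF] dF[of 0] that(2) by (simp add: G_def)
  next
    assume [simp]: "n = 2"
    have "frac_int 2 (deriv (deriv F)) t = F t - F 0"
      by (rule frac_int_deriv_deriv[OF that(1) cF]) (use dF[of 0] dF[of 1] that(2) F0 n(2) in \<open>auto simp: G_def numeral_2_eq_2\<close>)
    then show ?thesis by (simp add: G_def numeral_2_eq_2)
  qed
  have "h \<in> borel_measurable (restrict_space borel {0<..}) \<and> (\<forall>t>0. F t = F 0 + frac_int \<alpha> h t)"
  proof (cases "\<alpha> = real n")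
    case True
    have hG: "h t = G t" if "0 < t" for t
      using h[OF that] True by (simp add: caputo_deriv_def n_def[symmetric] G_def)
    have "(deriv ((deriv ^^ (n - 1)) F)) \<in> borel_measurable (restrict_space borel {0<..})"
      by (rule borel_measurable_deriv_half_line) (use dF[of "n - 1"] n in auto)
    moreover have "deriv ((deriv ^^ (n - 1)) F) = G"
      using n(1) by (auto simp: G_def numeral_2_eq_2)
    ultimately have mG: "G \<in> borel_measurable (restrict_space borel {0<..})" by simp
    then have mh: "h \<in> borel_measurable (restrict_space borel {0<..})"
      by (subst measurable_cong[of _ h G]) (auto simp: hG)
    have "F t = F 0 + frac_int \<alpha> h t" if t: "0 < t" for t
    proof -
      have "set_integrable lborel {0<..<t} G"
        unfolding set_integrable_def
      proof (rule Bochner_Integration.integrable_bound)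
        show "integrable lborel (\<lambda>s. indicator {0<..<t} s * C)"
          by (intro integrable_mult_left integrable_real_indicator) (use t in auto)
        have "(\<lambda>s. indicator {0<..<t} s * (indicator {0<..} s * G s)) \<in> borel_measurable borel"
          using mG by (simp add: borel_measurable_half_line_iff)
        also have "(\<lambda>s. indicator {0<..<t} s * (indicator {0<..} s * G s)) = (\<lambda>s. indicator {0<..<t} s *\<^sub>R G s)"
          by (auto simp: indicator_def fun_eq_iff)
        finally show "(\<lambda>s. indicator {0<..<t} s *\<^sub>R G s) \<in> borel_measurable lborel" by simp
        have "\<bar>G s\<bar> \<le> \<bar>C\<bar>" if "0 < s" for s using C[OF that] hG[OF that] by simp
        then show "AE s in lborel. norm (indicator {0<..<t} s *\<^sub>R G s) \<le> norm (indicator {0<..<t} s * C)"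
          by (intro AE_I2) (auto simp: indicator_def)
      qed
      from taylor[OF t this] show ?thesis
        using frac_int_cong[of t h G "real n"] hG True by simp
    qed
    with mh show ?thesis by blast
  next
    case False
    define b where "b = real n - \<alpha>"
    have b: "b > 0" "b < 1" using False n by (auto simp: b_def)
    have hG: "h t = frac_int b G t" if "0 < t" for t
      using h[OF that] False by (simp add: caputo_deriv_def n_def[symmetric] G_def b_def frac_int_def)
    (* On {0<..<t} the kernel with the negative exponent b - 1 is at least its value at s = 0,
       so dividing by it keeps integrability. *)
    have iG: "set_integrable lborel {0<..<t} G" if t: "0 < t" for t
    proof -
      have i: "integrable lborel (\<lambda>s. indicator {0<..<t} s *\<^sub>R (G s * (t - s) powr (b - 1)))"
        using iF[OF False t] by (simp add: set_integrable_def b_def)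
      then have [measurable]: "(\<lambda>s. indicator {0<..<t} s *\<^sub>R (G s * (t - s) powr (b - 1))) \<in> borel_measurable borel"
        by auto
      have eq: "indicator {0<..<t} s *\<^sub>R G s = (t - s) powr (1 - b) * (indicator {0<..<t} s *\<^sub>R (G s * (t - s) powr (b - 1)))" for s
        by (auto simp: indicator_def powr_add[symmetric])
      show ?thesis
        unfolding set_integrable_def
      proof (rule Bochner_Integration.integrable_bound)
        show "integrable lborel (\<lambda>s. t powr (1 - b) * (indicator {0<..<t} s *\<^sub>R (G s * (t - s) powr (b - 1))))"
          using i by simp
        show "(\<lambda>s. indicator {0<..<t} s *\<^sub>R G s) \<in> borel_measurable lborel"
          unfolding eq by measurable
        have "\<bar>(t - s) powr (1 - b) * (G s * (t - s) powr (b - 1))\<bar> \<le> \<bar>t powr (1 - b) * (G s * (t - s) powr (b - 1))\<bar>"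
          if "0 < s" "s < t" for s
          using that b by (auto simp: abs_mult intro!: mult_right_mono powr_mono2)
        then show "AE s in lborel. norm (indicator {0<..<t} s *\<^sub>R G s)
            \<le> norm (t powr (1 - b) * (indicator {0<..<t} s *\<^sub>R (G s * (t - s) powr (b - 1))))"
          unfolding eq by (intro AE_I2) (auto simp: indicator_def)
      qed
    qed
    have mG: "G \<in> borel_measurable (restrict_space borel {0<..})"
      unfolding borel_measurable_half_line_iff
    proof (rule borel_measurable_LIMSEQ_real)
      show "(\<lambda>s. indicator {0<..<real (Suc m)} s *\<^sub>R G s) \<in> borel_measurable borel" for m
        using iG[of "real (Suc m)"] by (auto simp: set_integrable_def)
      fix s :: real
      have "\<forall>\<^sub>F m in sequentially. s < real (Suc m)" by real_asymp
      then have "\<forall>\<^sub>F m in sequentially. indicator {0<..<real (Suc m)} s *\<^sub>R G s = indicator {0<..} s * G s"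
        by eventually_elim (auto simp: indicator_def)
      then show "(\<lambda>m. indicator {0<..<real (Suc m)} s *\<^sub>R G s) \<longlonglongrightarrow> indicator {0<..} s * G s"
        by (rule tendsto_eventually)
    qed
    have "frac_int b G \<in> borel_measurable borel"
      using borel_measurable_frac_int[of "\<lambda>s. indicator {0<..} s * G s" b] mG
      by (simp add: frac_int_indicator borel_measurable_half_line_iff)
    then have "frac_int b G \<in> borel_measurable (restrict_space borel {0<..})"
      by (rule measurable_restrict_space1)
    then have mh: "h \<in> borel_measurable (restrict_space borel {0<..})"
      by (subst measurable_cong[of _ h "frac_int b G"]) (auto simp: hG)
    have "F t = F 0 + frac_int \<alpha> h t" if t: "0 < t" for t
    proof -
      have "frac_int \<alpha> h t = frac_int \<alpha> (frac_int b G) t"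
        by (rule frac_int_cong) (simp add: hG)
      also have "\<dots> = frac_int (\<alpha> + b) G t"
        using n by (intro frac_int_semigroup \<alpha> b iG t) (auto simp: b_def)
      also have "\<dots> = F t - F 0" using taylor[OF t iG[OF t]] by (simp add: b_def)
      finally show ?thesis by simp
    qed
    with mh show ?thesis by blast
  qed
  then show "h \<in> borel_measurable (restrict_space borel {0<..})"
    and "\<And>t. 0 < t \<Longrightarrow> F t = F 0 + frac_int \<alpha> h t" by blast+
qed

section \<open>Laplace transforms in time\<close>

text \<open>
  The exponential law of rate \<open>z\<close>. The mean of \<open>f\<close> under it is \<open>z\<close> times the Laplace transform of \<open>f\<close>
  at \<open>z\<close>. The normalisation makes it a probability, so that bounded functions are integrable and
  constants are their own means. It lives on the open half line because the Caputo equations only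
  determine their right-hand sides at positive times.
\<close>

definition exp_law :: "real \<Rightarrow> real measure" where
  "exp_law z = density (restrict_space lborel {0<..}) (\<lambda>t. ennreal (z * exp (- z * t)))"

lemma space_exp_law [simp]: "space (exp_law z) = {0<..}"
  and sets_exp_law [measurable_cong]: "sets (exp_law z) = sets (restrict_space borel {0<..})"
  by (simp_all add: exp_law_def space_restrict_space sets_restrict_space_cong[OF sets_lborel])

lemma borel_measurable_exp_law:
  "f \<in> borel_measurable (restrict_space borel {0<..}) \<Longrightarrow> f \<in> borel_measurable (exp_law z)"
  by (subst measurable_cong_sets[OF sets_exp_law refl])

lemma integral_exp_law:
  fixes f :: "real \<Rightarrow> real"
  assumes z: "0 < z" and [measurable]: "f \<in> borel_measurable (restrict_space borel {0<..})"
  shows "(LINT t|exp_law z. f t) = (LINT t|lborel. indicator {0<..} t * (z * exp (- z * t) * f t))"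
proof -
  have [measurable]: "f \<in> borel_measurable (restrict_space lborel {0<..})"
    by (subst measurable_cong_sets[OF sets_restrict_space_cong refl, of _ borel]) auto
  have "(\<lambda>t. z * exp (- z * t)) \<in> borel_measurable (restrict_space lborel {0<..})"
    by (rule measurable_restrict_space1) simp
  then have [measurable]: "(\<lambda>t. z * exp (- (z * t))) \<in> borel_measurable (restrict_space lborel {0<..})"
    by simp
  have "(LINT t|exp_law z. f t) = (LINT t|restrict_space lborel {0<..}. z * exp (- z * t) * f t)"
    using z unfolding exp_law_def by (subst integral_density) auto
  also have "\<dots> = (LINT t|lborel. indicator {0<..} t * (z * exp (- z * t) * f t))"
    by (subst integral_restrict_space) auto
  finally show ?thesis .
qed

lemma prob_space_exp_law:
  assumes z: "0 < z"
  shows "prob_space (exp_law z)"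
proof
  have "has_bochner_integral lborel (\<lambda>t. z * (indicator {0<..} t * (exp (- z * t) * (t - 0) powr (1 - 1))))
      (z * (exp (- z * 0) * Gamma 1 / z powr 1))"
    using z by (intro has_bochner_integral_mult_right has_bochner_integral_Gamma_shift) auto
  also have "(\<lambda>t. z * (indicator {0<..} t * (exp (- z * t) * (t - 0) powr (1 - 1)))) = (\<lambda>t. indicator {0<..} t * (z * exp (- z * t)))"
    by (auto simp: indicator_def fun_eq_iff)
  also have "z * (exp (- z * 0) * Gamma 1 / z powr 1) = 1" using z by simp
  finally have B: "has_bochner_integral lborel (\<lambda>t. indicator {0<..} t * (z * exp (- z * t))) 1" .
  have "(\<lambda>t. ennreal (z * exp (- z * t))) \<in> borel_measurable (restrict_space lborel {0<..})"
    by (rule measurable_restrict_space1) simp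
  then have [measurable]: "(\<lambda>t. ennreal (z * exp (- (z * t)))) \<in> borel_measurable (restrict_space lborel {0<..})"
    by simp
  have "emeasure (exp_law z) (space (exp_law z)) = (\<integral>\<^sup>+t. ennreal (z * exp (- z * t)) * indicator {0<..} t \<partial>restrict_space lborel {0<..})"
    unfolding space_exp_law unfolding exp_law_def by (subst emeasure_density) (auto simp: sets_restrict_space)
  also have "\<dots> = (\<integral>\<^sup>+t. ennreal (indicator {0<..} t * (z * exp (- z * t))) \<partial>lborel)"
    by (subst nn_integral_restrict_space) (auto intro!: nn_integral_cong simp: indicator_def)
  also have "\<dots> = ennreal (LINT t|lborel. indicator {0<..} t * (z * exp (- z * t)))"
    using B z by (intro nn_integral_eq_integral) (auto simp: has_bochner_integral_iff intro!: AE_I2)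
  also have "\<dots> = 1"
    using B by (simp add: has_bochner_integral_iff)
  finally show "emeasure (exp_law z) (space (exp_law z)) = 1" .
qed

lemma measure_exp_law [simp]: "0 < z \<Longrightarrow> measure (exp_law z) {0<..} = 1"
  using prob_space.prob_space[OF prob_space_exp_law] by simp

lemma integrable_exp_law:
  fixes f :: "real \<Rightarrow> real"
  assumes z: "0 < z" and f: "f \<in> borel_measurable (restrict_space borel {0<..})"
    and C: "\<And>t. 0 < t \<Longrightarrow> \<bar>f t\<bar> \<le> C"
  shows "integrable (exp_law z) f"
proof -
  interpret prob_space "exp_law z" by (rule prob_space_exp_law[OF z])
  show ?thesis
    using C by (intro integrable_const_bound[where B = C] borel_measurable_exp_law f) (auto intro!: AE_I2)
qed

lemma integrable_exp_half_line:
  fixes z :: real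
  assumes z: "0 < z"
  shows "integrable lborel (\<lambda>s. indicator {0<..} s * exp (- z * s))"
proof -
  have "integrable lborel (\<lambda>t. indicator {0<..} t * (exp (- z * t) * (t - 0) powr (1 - 1)))"
    using has_bochner_integral_Gamma_shift[of 1 z 0] z by (auto simp: has_bochner_integral_iff)
  also have "(\<lambda>t. indicator {0<..} t * (exp (- z * t) * (t - 0) powr (1 - 1))) = (\<lambda>s. indicator {0<..} s * exp (- z * s))"
    by (auto simp: indicator_def fun_eq_iff)
  finally show ?thesis .
qed

text \<open>
  Fubini's theorem: the transform of the kernel that starts at \<open>s\<close> is \<open>exp (- z s)\<close> times a factor that
  does not depend on \<open>s\<close>.
\<close>

lemma integral_exp_law_frac_int:
  fixes f :: "real \<Rightarrow> real"
  assumes z: "0 < z" and a: "0 < a" and f: "f \<in> borel_measurable (restrict_space borel {0<..})"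
    and C: "\<And>t. 0 < t \<Longrightarrow> \<bar>f t\<bar> \<le> C"
  shows "(LINT t|exp_law z. frac_int a f t) = (LINT t|exp_law z. f t) / z powr a"
proof -
  define f' where "f' = (\<lambda>s. indicator {0<..} s * f s)"
  have [measurable]: "f' \<in> borel_measurable borel"
    using f by (simp add: f'_def borel_measurable_half_line_iff)
  have fi: "frac_int a f' = frac_int a f" unfolding f'_def by (rule frac_int_indicator)
  have m: "frac_int a f \<in> borel_measurable (restrict_space borel {0<..})"
    using borel_measurable_frac_int[of f' a] by (intro measurable_restrict_space1) (simp add: fi)
  define k where "k = (\<lambda>s t. indicator {s<..} t * (exp (- z * t) * (t - s) powr (a - 1)))"
  have km: "case_prod k \<in> borel_measurable (borel \<Otimes>\<^sub>M borel)"
  proof -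
    have "case_prod k = (\<lambda>(s, t). (if s < t then 1 else 0) * (exp (- z * t) * (t - s) powr (a - 1)))"
      by (auto simp: k_def fun_eq_iff)
    then show ?thesis by simp
  qed
  define K where "K = (\<lambda>s. exp (- z * s) * Gamma a / z powr a)"
  have G: "Gamma a \<noteq> 0" using a Gamma_real_pos[of a] by linarith
  have "(LINT t|exp_law z. frac_int a f t) = (LINT t|lborel. indicator {0<..} t * (z * exp (- z * t) * frac_int a f t))"
    by (rule integral_exp_law[OF z m])
  also have "\<dots> = (LINT t|lborel. z / Gamma a * (LINT s|lborel. f' s * k s t))"
  proof (rule Bochner_Integration.integral_cong[OF refl])
    fix t
    show "indicator {0<..} t * (z * exp (- z * t) * frac_int a f t) = z / Gamma a * (LINT s|lborel. f' s * k s t)"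
    proof (cases "0 < t")
      case True
      have "(LINT s|lborel. f' s * k s t) = (LINT s|lborel. exp (- z * t) * (indicator {0<..<t} s *\<^sub>R (f s * (t - s) powr (a - 1))))"
        by (rule Bochner_Integration.integral_cong) (auto simp: f'_def k_def indicator_def)
      then show ?thesis using True by (simp add: frac_int_def set_lebesgue_integral_def)
    next
      case False
      then have "(\<lambda>s. f' s * k s t) = (\<lambda>s. 0)" by (auto simp: f'_def k_def indicator_def fun_eq_iff)
      then show ?thesis using False by simp
    qed
  qed
  also have "\<dots> = z / Gamma a * (LINT t|lborel. LINT s|lborel. f' s * k s t)"
    by simp
  also have "(LINT t|lborel. LINT s|lborel. f' s * k s t) = (LINT s|lborel. f' s * K s)"
  proof (rule integral_nonneg_kernel_swap[OF km])
    show "has_bochner_integral lborel (k s) (K s)" for s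
      unfolding k_def K_def by (rule has_bochner_integral_Gamma_shift[OF a z])
    show "integrable lborel (\<lambda>s. f' s * K s)"
    proof (rule Bochner_Integration.integrable_bound)
      show "integrable lborel (\<lambda>s. (\<bar>C\<bar> * (Gamma a / z powr a)) * (indicator {0<..} s * exp (- z * s)))"
        by (intro integrable_mult_right integrable_exp_half_line z)
      show "(\<lambda>s. f' s * K s) \<in> borel_measurable lborel" unfolding K_def by measurable
      have "\<bar>f s * (exp (- (z * s)) * Gamma a)\<bar> \<le> \<bar>C * (Gamma a * exp (- (z * s)))\<bar>" if "0 < s" for s
        using C[OF that] by (auto simp: abs_mult intro!: mult_mono)
      then show "AE s in lborel. norm (f' s * K s) \<le> norm ((\<bar>C\<bar> * (Gamma a / z powr a)) * (indicator {0<..} s * exp (- z * s)))"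
        using z by (intro AE_I2) (auto simp: f'_def K_def indicator_def abs_mult divide_right_mono)
    qed
  qed (auto simp: k_def)
  also have "z / Gamma a * (LINT s|lborel. f' s * K s) = (LINT s|lborel. z / Gamma a * (f' s * K s))" by simp
  also have "\<dots> = (LINT s|lborel. (1 / z powr a) * (indicator {0<..} s * (z * exp (- z * s) * f s)))"
    using G by (intro Bochner_Integration.integral_cong) (auto simp: f'_def K_def indicator_def)
  also have "\<dots> = (LINT t|exp_law z. f t) / z powr a"
    by (simp add: integral_exp_law[OF z f])
  finally show ?thesis .
qed

text \<open>
  The Laplace transform of a Caputo equation, read off from its Volterra form. All the functions that
  occur are bounded, so every integral converges absolutely.
\<close>

lemma integral_exp_law_caputo:
  fixes F h :: "real \<Rightarrow> real"
  assumes z: "0 < z" and \<alpha>: "0 < \<alpha>" "\<alpha> \<le> 2" and F: "caputo_differentiable \<alpha> F"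
    and F0: "1 < \<alpha> \<Longrightarrow> (F has_real_derivative 0) (at 0 within {0..})"
    and h: "\<And>t. 0 < t \<Longrightarrow> caputo_deriv \<alpha> F t = h t" and C: "\<And>t. 0 < t \<Longrightarrow> \<bar>h t\<bar> \<le> C"
    and B: "\<And>t. 0 < t \<Longrightarrow> \<bar>F t\<bar> \<le> B"
  shows "(LINT t|exp_law z. F t) = F 0 + (LINT t|exp_law z. h t) / z powr \<alpha>"
proof -
  interpret prob_space "exp_law z" by (rule prob_space_exp_law[OF z])
  note inv = caputo_inversion[OF \<alpha> F F0 h C]
  have "continuous_on {0<..} F"
    using F unfolding caputo_differentiable_def Let_def by (auto intro: continuous_on_subset)
  then have Fm: "F \<in> borel_measurable (restrict_space borel {0<..})"
    by (rule borel_measurable_continuous_on_restrict)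
  have "(LINT t|exp_law z. F t) - F 0 = (LINT t|exp_law z. F t - F 0)"
    using integrable_exp_law[OF z Fm B] z by simp
  also have "\<dots> = (LINT t|exp_law z. frac_int \<alpha> h t)"
    by (rule Bochner_Integration.integral_cong) (use inv(2) in auto)
  also have "\<dots> = (LINT t|exp_law z. h t) / z powr \<alpha>"
    by (rule integral_exp_law_frac_int[OF z \<alpha>(1) inv(1) C])
  finally show ?thesis by simp
qed

text \<open>
  Uniqueness of the Laplace transform. Put \<open>u = exp(- t)\<close>. The transforms at the positive integers say
  that \<open>f\<close> is orthogonal to all powers of \<open>u\<close> under the exponential law of rate 1. The function
  \<open>w(u) = u f(- ln u)\<close> is continuous on \<open>{0..1}\<close>, at 0 because \<open>f\<close> is bounded, and so it is a uniform limit of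
  polynomials; hence \<open>f\<close> is orthogonal to \<open>w(exp(- t)) = exp(- t) f(t)\<close>, and \<open>exp(- t) f(t)\<^sup>2\<close> has integral 0.
\<close>

lemma exp_law_integral_unique:
  fixes f :: "real \<Rightarrow> real"
  assumes f: "continuous_on {0..} f" and C: "\<And>t. 0 \<le> t \<Longrightarrow> \<bar>f t\<bar> \<le> C"
    and zero: "\<And>z. 0 < z \<Longrightarrow> (LINT t|exp_law z. f t) = 0" and t: "0 < t"
  shows "f t = 0"
proof -
  have f': "continuous_on {0<..} f" by (rule continuous_on_subset[OF f]) auto
  have fm: "f \<in> borel_measurable (restrict_space borel {0<..})"
    by (rule borel_measurable_continuous_on_restrict[OF f'])
  interpret E: prob_space "exp_law 1" by (rule prob_space_exp_law) simp
  have iE: "integrable (exp_law 1) g" if "continuous_on {0<..} g" "\<And>t. 0 < t \<Longrightarrow> \<bar>g t\<bar> \<le> D" for g :: "real \<Rightarrow> real" and D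
    by (rule integrable_exp_law[OF _ borel_measurable_continuous_on_restrict[OF that(1)] that(2)]) simp_all
  have C0: "0 \<le> C" using C[of 0] by linarith
  define e where "e t = exp (- t)" for t :: real
  have e: "0 < e t" "0 < t \<Longrightarrow> e t < 1" "0 \<le> t \<Longrightarrow> e t \<le> 1" for t by (auto simp: e_def)
  have ce: "continuous_on {0<..} e" unfolding e_def by (intro continuous_intros)
  have mom: "(LINT t|exp_law 1. f t * e t ^ n) = 0" for n
  proof -
    have m: "(\<lambda>t. f t * e t ^ n) \<in> borel_measurable (restrict_space borel {0<..})"
      by (intro borel_measurable_continuous_on_restrict continuous_intros f' ce)
    have "(LINT t|exp_law 1. f t * e t ^ n) =
       (LINT t|lborel. indicator {0<..} t * (1 * exp (- 1 * t) * (f t * e t ^ n)))"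
      by (rule integral_exp_law[OF _ m]) simp
    also have "\<dots> = (LINT t|lborel. (1 / (real n + 1)) * (indicator {0<..} t * ((real n + 1) * exp (- (real n + 1) * t) * f t)))"
    proof (rule Bochner_Integration.integral_cong[OF refl])
      fix t :: real
      have *: "exp (- (real n + 1) * t) = exp (- t) * e t ^ n"
        by (simp add: e_def exp_of_nat_mult[symmetric] exp_add[symmetric] algebra_simps)
      have "real n + 1 \<noteq> 0" by linarith
      then show "indicator {0<..} t * (1 * exp (- 1 * t) * (f t * e t ^ n)) =
        (1 / (real n + 1)) * (indicator {0<..} t * ((real n + 1) * exp (- (real n + 1) * t) * f t))"
        unfolding * by simp
    qed
    also have "\<dots> = 1 / (real n + 1) * (LINT t|exp_law (real n + 1). f t)"
    proof -
      have pos: "0 < real n + 1" by linarith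
      show ?thesis unfolding integral_exp_law[OF pos fm] by (rule integral_mult_right_zero)
    qed
    finally show ?thesis using zero[of "real n + 1"] by simp
  qed
  define w where "w u = (if u = 0 then 0 else u * f (- ln u))" for u
  have we: "w (e t) = e t * f t" for t by (simp add: w_def e_def)
  have cw: "continuous_on {0..1} w"
    unfolding continuous_on_eq_continuous_within
  proof
    fix u :: real assume u: "u \<in> {0..1}"
    show "continuous (at u within {0..1}) w"
    proof (cases "u = 0")
      case True
      have "\<bar>w v\<bar> \<le> C * \<bar>v\<bar>" if "v \<in> {0..1}" for v
      proof (cases "v = 0")
        case False
        then have "\<bar>f (- ln v)\<bar> \<le> C" using that by (intro C) auto
        then show ?thesis by (simp add: w_def abs_mult mult.commute mult_left_mono)
      qed (simp add: w_def)
      then have "\<forall>\<^sub>F v in at 0 within {0..1}. norm (w v) \<le> C * \<bar>v\<bar>"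
        by (auto simp: eventually_at_filter intro!: always_eventually)
      moreover have "((\<lambda>v. C * \<bar>v\<bar>) \<longlongrightarrow> 0) (at 0 within {0..1})"
        by (auto intro!: tendsto_eq_intros)
      ultimately have "(w \<longlongrightarrow> 0) (at 0 within {0..1})"
        by (rule Lim_null_comparison)
      then show ?thesis using True by (simp add: continuous_within w_def)
    next
      case False
      with u have u: "u \<in> {0<..1}" by auto
      have "continuous_on {0<..1} (\<lambda>v. v * f (- ln v))"
        by (intro continuous_intros continuous_on_compose2[OF f]) auto
      then have "continuous_on {0<..1} w"
        by (rule continuous_on_cong[THEN iffD1, rotated -1]) (auto simp: w_def)
      then have "continuous (at u within {0<..1}) w"
        using u by (simp add: continuous_on_eq_continuous_within)
      moreover have "at u within {0<..1} = at u within {0..1}"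
        by (rule at_within_nhd[of _ "{0<..}"]) (use u in auto)
      ultimately show ?thesis by simp
    qed
  qed
  define I where "I = (LINT t|exp_law 1. f t * w (e t))"
  have cwe: "continuous_on {0<..} (\<lambda>t. w (e t))"
    using ce f' by (auto simp: we intro!: continuous_intros)
  have wb: "\<bar>w (e t)\<bar> \<le> C" if "0 \<le> t" for t
    using mult_mono[of "e t" 1 "\<bar>f t\<bar>" C] e(1)[of t] e(3)[OF that] C[OF that] by (simp add: we abs_mult)
  have "\<bar>I\<bar> \<le> C * \<epsilon>" if \<epsilon>: "0 < \<epsilon>" for \<epsilon>
  proof -
    obtain n where n: "\<And>u. u \<in> {0..1} \<Longrightarrow> \<bar>w u - (\<Sum>k\<le>n. w (k/n) * Bernstein n k u)\<bar> < \<epsilon>"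
      using Bernstein_Weierstrass[OF cw \<epsilon>] by blast
    define p where "p u = (\<Sum>k\<le>n. w (k/n) * Bernstein n k u)" for u
    have "(LINT t|exp_law 1. f t * p (e t)) = 0"
    proof -
      have "p u = poly (\<Sum>k\<le>n. [:w (k/n) * of_nat (n choose k):] * [:0, 1:] ^ k * [:1, -1:] ^ (n - k)) u" for u
        by (simp add: p_def Bernstein_def poly_sum mult_ac)
      then obtain P where P: "\<And>u. p u = poly P u" by blast
      have "(LINT t|exp_law 1. f t * p (e t)) = (LINT t|exp_law 1. (\<Sum>i\<le>degree P. coeff P i * (f t * e t ^ i)))"
        by (simp add: P poly_altdef sum_distrib_left mult_ac)
      also have "\<dots> = (\<Sum>i\<le>degree P. LINT t|exp_law 1. coeff P i * (f t * e t ^ i))"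
      proof (rule Bochner_Integration.integral_sum)
        fix i
        have "\<bar>f t * e t ^ i\<bar> \<le> C" if "0 < t" for t
          using mult_mono[of "\<bar>f t\<bar>" C "e t ^ i" 1] C[of t] that e(1)[of t] e(2)[of t] C0
          by (simp add: abs_mult power_le_one)
        then show "integrable (exp_law 1) (\<lambda>t. coeff P i * (f t * e t ^ i))"
          by (intro integrable_mult_right iE continuous_intros f' ce)
      qed
      also have "\<dots> = 0" by (simp add: mom)
      finally show ?thesis .
    qed
    have cp: "continuous_on {0<..} (\<lambda>t. p (e t))"
      unfolding p_def Bernstein_def by (intro continuous_intros ce)
    have pb: "\<bar>p (e t)\<bar> \<le> C + \<epsilon>" if "0 < t" for t
      using n[of "e t"] wb[of t] e(1)[of t] e(3)[of t] that unfolding p_def[symmetric] by auto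
    have b: "\<bar>f t * (w (e t) - p (e t))\<bar> \<le> C * \<epsilon>" if "0 < t" for t
      using n[of "e t"] e(1)[of t] e(3)[of t] that C[of t] unfolding p_def[symmetric]
      by (auto simp: abs_mult intro!: mult_mono)
    have "I = (LINT t|exp_law 1. f t * w (e t)) - (LINT t|exp_law 1. f t * p (e t))"
      using \<open>(LINT t|exp_law 1. f t * p (e t)) = 0\<close> by (simp add: I_def)
    also have "\<dots> = (LINT t|exp_law 1. f t * w (e t) - f t * p (e t))"
    proof (rule Bochner_Integration.integral_diff[symmetric])
      show "integrable (exp_law 1) (\<lambda>t. f t * w (e t))"
        by (rule integrable_exp_law[where C = "C * C"]) (auto intro!: borel_measurable_continuous_on_restrict continuous_intros f' cwe mult_mono C wb simp: abs_mult C0)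
      show "integrable (exp_law 1) (\<lambda>t. f t * p (e t))"
        by (rule integrable_exp_law[where C = "C * (C + \<epsilon>)"]) (use \<epsilon> C0 in \<open>auto intro!: borel_measurable_continuous_on_restrict continuous_intros f' cp mult_mono C pb simp: abs_mult\<close>)
    qed
    also have "\<bar>\<dots>\<bar> \<le> (LINT t|exp_law 1. C * \<epsilon>)"
      using measure_exp_law[of 1]
      by (intro order_trans[OF integral_abs_bound] integral_mono' integrable_const)
         (use b \<epsilon> C0 in \<open>auto simp: right_diff_distrib\<close>)
    also have "\<dots> = C * \<epsilon>" using measure_exp_law[of 1] by simp
    finally show ?thesis .
  qed
  note I_le = this
  have I0: "I = 0"
  proof (rule ccontr)
    assume "I \<noteq> 0"
    moreover have "C \<noteq> 0" using I_le[of 1] \<open>I \<noteq> 0\<close> by auto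
    ultimately show False
      using I_le[of "\<bar>I\<bar> / (2 * C)"] C0 by simp
  qed
  have I: "I = (LINT s|lborel. indicator {0<..} s * (e s * (f s * (e s * f s))))"
  proof -
    have "(\<lambda>t. f t * w (e t)) \<in> borel_measurable (restrict_space borel {0<..})"
      by (intro borel_measurable_continuous_on_restrict continuous_intros f' cwe)
    from integral_exp_law[OF _ this, of 1] show ?thesis
      unfolding I_def we by (simp add: e_def)
  qed
  define q where "q s = e s * (f s * (e s * f s))" for s
  have q: "0 \<le> q s" for s
  proof -
    have "q s = (e s * f s)\<^sup>2" by (simp add: q_def power2_eq_square mult_ac)
    then show ?thesis by simp
  qed
  have cq: "continuous_on {t..t+1} q"
    unfolding q_def by (intro continuous_intros continuous_on_subset[OF f'] continuous_on_subset[OF ce]) (use t in auto)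
  have "integrable lborel (\<lambda>s. indicator {0<..} s * q s)"
  proof (rule Bochner_Integration.integrable_bound)
    show "integrable lborel (\<lambda>s. C * C * (indicator {0<..} s * exp (- 1 * s)))"
      by (intro integrable_mult_right integrable_exp_half_line) simp
    have "q \<in> borel_measurable (restrict_space borel {0<..})"
      unfolding q_def by (intro borel_measurable_continuous_on_restrict continuous_intros ce f')
    then show "(\<lambda>s. indicator {0<..} s * q s) \<in> borel_measurable lborel"
      by (simp add: borel_measurable_half_line_iff)
    have "\<bar>q s\<bar> \<le> C * C * exp (- s)" if "0 < s" for s
    proof -
      have "\<bar>f s\<bar> * \<bar>w (e s)\<bar> \<le> C * C" using that by (intro mult_mono C wb C0) auto
      then have "e s * (\<bar>f s\<bar> * \<bar>w (e s)\<bar>) \<le> e s * (C * C)" using e(1)[of s] by (intro mult_left_mono) auto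
      also have "e s * (\<bar>f s\<bar> * \<bar>w (e s)\<bar>) = \<bar>q s\<bar>"
        using e(1)[of s] by (simp add: q_def we abs_mult)
      also have "e s * (C * C) = C * C * exp (- s)" by (simp add: e_def)
      finally show ?thesis .
    qed
    then show "AE s in lborel. norm (indicator {0<..} s * q s) \<le> norm (C * C * (indicator {0<..} s * exp (- 1 * s)))"
      by (intro AE_I2) (auto simp: indicator_def abs_mult)
  qed
  have "integral {t..t+1} q = (LBINT s:{t..t+1}. q s)"
    by (rule set_borel_integral_eq_integral(2)[symmetric]) (rule borel_integrable_atLeastAtMost', rule cq)
  also have "\<dots> \<le> (LINT s|lborel. indicator {0<..} s * q s)"
    unfolding set_lebesgue_integral_def
  proof (rule integral_mono')
    show "integrable lborel (\<lambda>s. indicator {0<..} s * q s)" by fact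
  qed (use q t in \<open>auto simp: indicator_def\<close>)
  also have "\<dots> = 0" using I0 I by (simp add: q_def)
  finally have "integral {t..t+1} q = 0"
    using Henstock_Kurzweil_Integration.integral_nonneg[of q "{t..t+1}"] q integrable_continuous_real[OF cq] by auto
  then have "q t = 0" using integral_eq_0_iff[OF cq] q by auto
  then show ?thesis using e(1)[of t] by (auto simp: q_def)
qed

section \<open>Smooth cutoffs\<close>

lemma has_real_derivative_max_power:
  fixes y :: real
  shows "((\<lambda>y. max 0 y ^ Suc (Suc n)) has_real_derivative real (Suc (Suc n)) * max 0 y ^ Suc n) (at y)"
proof (cases y "0::real" rule: linorder_cases)
  case less
  have "((\<lambda>y. 0) has_real_derivative 0) (at y)" by simp
  then have "((\<lambda>y. max 0 y ^ Suc (Suc n)) has_real_derivative 0) (at y)"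
    by (rule has_field_derivative_transform_within_open[of _ _ _ "{..<0}"]) (use less in auto)
  then show ?thesis using less by simp
next
  case greater
  have "((\<lambda>y. y ^ Suc (Suc n)) has_real_derivative real (Suc (Suc n)) * y ^ Suc n) (at y)"
    using DERIV_pow[of "Suc (Suc n)" y UNIV] by simp
  then have "((\<lambda>y. max 0 y ^ Suc (Suc n)) has_real_derivative real (Suc (Suc n)) * y ^ Suc n) (at y)"
    by (rule has_field_derivative_transform_within_open[of _ _ _ "{0<..}"]) (use greater in auto)
  then show ?thesis using greater by simp
next
  case equal
  have "((\<lambda>h. max 0 h ^ Suc (Suc n) / h) \<longlongrightarrow> 0) (at (0::real))"
  proof (rule Lim_null_comparison)
    show "\<forall>\<^sub>F h in at (0::real). norm (max 0 h ^ Suc (Suc n) / h) \<le> \<bar>h\<bar> ^ Suc n"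
      by (auto simp: eventually_at_filter max_def mult_nonpos_nonneg intro!: always_eventually)
    show "((\<lambda>h::real. \<bar>h\<bar> ^ Suc n) \<longlongrightarrow> 0) (at 0)"
      by (auto intro!: tendsto_eq_intros)
  qed
  then show ?thesis using equal by (simp add: DERIV_def)
qed

text \<open>
  A cutoff that equals 1 at 0, vanishes outside the ball of radius \<open>r\<close>, is even, and is twice
  continuously differentiable: 3 is the least exponent for which a power of the positive part is.
  The next two functions are its derivatives. Evenness keeps the Neumann condition when a function is
  multiplied by it.
\<close>

definition cutoff :: "real \<Rightarrow> real \<Rightarrow> real" where
  "cutoff r x = max 0 (1 - (x / r)\<^sup>2) ^ 3"

definition cutoff' :: "real \<Rightarrow> real \<Rightarrow> real" where
  "cutoff' r x = - 6 * (x / r) / r * max 0 (1 - (x / r)\<^sup>2) ^ 2"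

definition cutoff'' :: "real \<Rightarrow> real \<Rightarrow> real" where
  "cutoff'' r x = - 6 / r\<^sup>2 * max 0 (1 - (x / r)\<^sup>2) ^ 2 + 24 * (x / r)\<^sup>2 / r\<^sup>2 * max 0 (1 - (x / r)\<^sup>2)"

lemma has_real_derivative_cutoff:
  assumes r: "0 < r"
  shows "(cutoff r has_real_derivative cutoff' r x) (at x)"
    and "(cutoff' r has_real_derivative cutoff'' r x) (at x)"
proof -
  have d: "((\<lambda>x. 1 - (x / r)\<^sup>2) has_real_derivative - 2 * (x / r) / r) (at x)"
    using r by (auto intro!: derivative_eq_intros simp: field_simps power2_eq_square)
  have p3: "((\<lambda>x. max 0 (1 - (x / r)\<^sup>2) ^ 3) has_real_derivative (3 * max 0 (1 - (x / r)\<^sup>2) ^ 2) * (- 2 * (x / r) / r)) (at x)"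
    using DERIV_chain2[OF has_real_derivative_max_power[of 1] d] by (simp add: eval_nat_numeral)
  then show "(cutoff r has_real_derivative cutoff' r x) (at x)"
    unfolding cutoff_def[abs_def] cutoff'_def by (rule DERIV_cong) (use r in \<open>simp add: field_simps\<close>)
  have p2: "((\<lambda>x. max 0 (1 - (x / r)\<^sup>2) ^ 2) has_real_derivative (2 * max 0 (1 - (x / r)\<^sup>2)) * (- 2 * (x / r) / r)) (at x)"
    using DERIV_chain2[OF has_real_derivative_max_power[of 0] d] by (simp add: eval_nat_numeral)
  have l: "((\<lambda>x. - 6 * (x / r) / r) has_real_derivative - 6 / r\<^sup>2) (at x)"
    using r by (auto intro!: derivative_eq_intros simp: field_simps power2_eq_square)
  show "(cutoff' r has_real_derivative cutoff'' r x) (at x)"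
    unfolding cutoff'_def[abs_def] cutoff''_def
    by (rule DERIV_cong[OF DERIV_mult[OF l p2]]) (use r in \<open>simp add: field_simps power2_eq_square\<close>)
qed

lemma cutoff_bounds:
  assumes r: "1 \<le> r"
  shows "0 \<le> cutoff r x" "cutoff r x \<le> 1" "\<bar>cutoff' r x\<bar> \<le> 6" "\<bar>cutoff'' r x\<bar> \<le> 30"
proof -
  define m where "m = max 0 (1 - (x / r)\<^sup>2)"
  have m: "0 \<le> m" "m \<le> 1" by (auto simp: m_def)
  have m2: "0 \<le> m\<^sup>2" "m\<^sup>2 \<le> 1" using m by (auto simp: power_le_one)
  show "0 \<le> cutoff r x" "cutoff r x \<le> 1"
    unfolding cutoff_def m_def[symmetric] using m by (auto simp: power_le_one)
  have r2: "0 \<le> 1 / r\<^sup>2" "1 / r\<^sup>2 \<le> 1" using r by (auto simp: one_le_power)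
  have r1: "0 \<le> 1 / r" "1 / r \<le> 1" using r by auto
  have xm: "\<bar>x / r\<bar> \<le> 1" if "m \<noteq> 0"
    using that unfolding m_def by (simp add: max_def abs_square_le_1 split: if_splits)
  show "\<bar>cutoff' r x\<bar> \<le> 6"
  proof (cases "m = 0")
    case True then show ?thesis by (simp add: cutoff'_def m_def)
  next
    case False
    have "\<bar>x / r\<bar> * (1 / r) * m\<^sup>2 \<le> 1 * 1 * 1"
      using xm[OF False] r1 m2 r by (intro mult_mono) auto
    moreover have "cutoff' r x = - 6 * ((x / r) * (1 / r) * m\<^sup>2)"
      unfolding cutoff'_def m_def[symmetric] by simp
    then have "\<bar>cutoff' r x\<bar> = 6 * (\<bar>x / r\<bar> * (1 / r) * m\<^sup>2)"
      using r by (simp add: abs_mult)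
    ultimately show ?thesis by linarith
  qed
  show "\<bar>cutoff'' r x\<bar> \<le> 30"
  proof (cases "m = 0")
    case True then show ?thesis by (simp add: cutoff''_def m_def)
  next
    case False
    have x2: "(x / r)\<^sup>2 \<le> 1" "0 \<le> (x/r)\<^sup>2" using xm[OF False] by (auto simp: abs_square_le_1)
    have a: "1 / r\<^sup>2 * m\<^sup>2 \<le> 1 * 1" "0 \<le> 1 / r\<^sup>2 * m\<^sup>2"
      using r2 m2 by (intro mult_mono mult_nonneg_nonneg; simp)+
    have b: "(x / r)\<^sup>2 * (1 / r\<^sup>2) * m \<le> 1 * 1 * 1" "0 \<le> (x / r)\<^sup>2 * (1 / r\<^sup>2) * m"
      using r2 m x2 by (intro mult_mono mult_nonneg_nonneg; simp)+
    have "cutoff'' r x = - 6 * (1 / r\<^sup>2 * m\<^sup>2) + 24 * ((x / r)\<^sup>2 * (1 / r\<^sup>2) * m)"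
      unfolding cutoff''_def m_def[symmetric] by simp
    then show ?thesis using a b by linarith
  qed
qed

lemma cutoff_outside: "0 < r \<Longrightarrow> r \<le> \<bar>x\<bar> \<Longrightarrow> cutoff r x = 0"
  using power_mono[of 1 "\<bar>x\<bar> / r" 2] by (simp add: cutoff_def power_divide max_def field_simps)

text \<open>
  The error of the cutoff is quadratic in \<open>x / r\<close>; it is uniformly small against a function that decays
  like \<open>1 / x\<^sup>2\<close>.
\<close>

lemma one_minus_cutoff_le: "1 - cutoff r x \<le> 3 * (x / r)\<^sup>2"
proof (cases "(x / r)\<^sup>2 \<le> 1")
  case True
  define y where "y = (x / r)\<^sup>2"
  have y: "0 \<le> y" "y \<le> 1" using True by (auto simp: y_def)
  have "1 - (1 - y) ^ 3 = 3 * y - y\<^sup>2 * (3 - y)" by (simp add: power3_eq_cube power2_eq_square algebra_simps)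
  also have "\<dots> \<le> 3 * y" using y by simp
  finally show ?thesis using y by (simp add: cutoff_def y_def[symmetric])
next
  case False
  then show ?thesis by (simp add: cutoff_def max_def)
qed

lemma cutoff_tendsto:
  "(\<lambda>n. cutoff (real (Suc n)) x) \<longlonglongrightarrow> 1" "(\<lambda>n. cutoff' (real (Suc n)) x) \<longlonglongrightarrow> 0"
  "(\<lambda>n. cutoff'' (real (Suc n)) x) \<longlonglongrightarrow> 0"
proof -
  have r: "(\<lambda>n. c / real (Suc n)) \<longlonglongrightarrow> 0" for c :: real by real_asymp
  have r2: "(\<lambda>n. c / (real (Suc n))\<^sup>2) \<longlonglongrightarrow> 0" for c :: real by real_asymp
  have m: "(\<lambda>n. max 0 (1 - (x / real (Suc n))\<^sup>2)) \<longlonglongrightarrow> max 0 (1 - 0\<^sup>2)"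
    by (intro tendsto_intros r)
  show "(\<lambda>n. cutoff (real (Suc n)) x) \<longlonglongrightarrow> 1"
    unfolding cutoff_def using tendsto_power[OF m, of 3] by simp
  have "(\<lambda>n. - 6 * (x / real (Suc n)) * (1 / real (Suc n)) * max 0 (1 - (x / real (Suc n))\<^sup>2) ^ 2) \<longlonglongrightarrow> - 6 * 0 * 0 * max 0 (1 - 0\<^sup>2) ^ 2"
    by (intro tendsto_intros r)
  then show "(\<lambda>n. cutoff' (real (Suc n)) x) \<longlonglongrightarrow> 0"
    unfolding cutoff'_def by simp
  have "(\<lambda>n. - 6 / (real (Suc n))\<^sup>2 * max 0 (1 - (x / real (Suc n))\<^sup>2) ^ 2
      + 24 * ((x / real (Suc n))\<^sup>2 * (1 / (real (Suc n))\<^sup>2)) * max 0 (1 - (x / real (Suc n))\<^sup>2))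
      \<longlonglongrightarrow> 0 * max 0 (1 - 0\<^sup>2) ^ 2 + 24 * (0\<^sup>2 * 0) * max 0 (1 - 0\<^sup>2)"
    by (intro tendsto_intros r r2)
  then show "(\<lambda>n. cutoff'' (real (Suc n)) x) \<longlonglongrightarrow> 0"
    unfolding cutoff''_def by simp
qed

lemma neumann_test_function_mult_cutoff:
  fixes \<phi> \<phi>' \<phi>'' :: "real \<Rightarrow> real"
  assumes d1: "\<And>x. (\<phi> has_real_derivative \<phi>' x) (at x)"
    and d2: "\<And>x. (\<phi>' has_real_derivative \<phi>'' x) (at x)"
    and c: "continuous_on UNIV \<phi>''" and \<phi>0: "\<phi>' 0 = 0" and r: "0 < r"
  shows "neumann_test_function (\<lambda>x. \<phi> x * cutoff r x)"
    and "deriv (deriv (\<lambda>x. \<phi> x * cutoff r x)) =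
           (\<lambda>x. \<phi>'' x * cutoff r x + 2 * \<phi>' x * cutoff' r x + \<phi> x * cutoff'' r x)"
proof -
  note k = has_real_derivative_cutoff[OF r]
  have 1: "((\<lambda>x. \<phi> x * cutoff r x) has_real_derivative \<phi>' x * cutoff r x + \<phi> x * cutoff' r x) (at x)" for x
    by (rule DERIV_cong[OF DERIV_mult[OF d1 k(1)]]) simp
  then have e1: "deriv (\<lambda>x. \<phi> x * cutoff r x) = (\<lambda>x. \<phi>' x * cutoff r x + \<phi> x * cutoff' r x)"
    by (auto intro: DERIV_imp_deriv)
  have 2: "((\<lambda>x. \<phi>' x * cutoff r x + \<phi> x * cutoff' r x) has_real_derivative
       \<phi>'' x * cutoff r x + 2 * \<phi>' x * cutoff' r x + \<phi> x * cutoff'' r x) (at x)" for x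
    by (rule DERIV_cong[OF DERIV_add[OF DERIV_mult[OF d2 k(1)] DERIV_mult[OF d1 k(2)]]]) simp
  then show e2: "deriv (deriv (\<lambda>x. \<phi> x * cutoff r x)) =
       (\<lambda>x. \<phi>'' x * cutoff r x + 2 * \<phi>' x * cutoff' r x + \<phi> x * cutoff'' r x)"
    unfolding e1 by (auto intro: DERIV_imp_deriv)
  have cont: "continuous_on UNIV \<phi>" "continuous_on UNIV \<phi>'" "continuous_on UNIV (cutoff r)" "continuous_on UNIV (cutoff' r)"
    using d1 d2 k by (auto intro!: continuous_at_imp_continuous_on DERIV_isCont)
  have c2: "continuous_on UNIV (cutoff'' r)"
    unfolding cutoff''_def[abs_def] using r by (intro continuous_intros) auto
  have "{x. \<phi> x * cutoff r x \<noteq> 0} \<subseteq> cball 0 r"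
    using cutoff_outside[OF r] by (auto simp: dist_real_def) (metis linear)
  then have "bounded {x. \<phi> x * cutoff r x \<noteq> 0}"
    using bounded_cball bounded_subset by blast
  moreover have "(\<lambda>x. \<phi> x * cutoff r x) differentiable (at x)" for x
    using 1 real_differentiable_def by blast
  moreover have "deriv (\<lambda>x. \<phi> x * cutoff r x) differentiable (at x)" for x
    using 2 e1 real_differentiable_def by metis
  moreover have "continuous_on UNIV (deriv (deriv (\<lambda>x. \<phi> x * cutoff r x)))"
    unfolding e2 by (intro continuous_intros c cont c2)
  moreover have "deriv (\<lambda>x. \<phi> x * cutoff r x) 0 = 0"
    by (simp add: e1 \<phi>0 cutoff'_def)
  ultimately show "neumann_test_function (\<lambda>x. \<phi> x * cutoff r x)"
    unfolding neumann_test_function_def by blast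
qed

section \<open>The Cauchy problem after the Laplace transform\<close>

locale half_line_law = prob_space M for M :: "real measure" +
  assumes sets_eq [measurable_cong]: "sets M = sets borel" and negative_null: "emeasure M {..<0} = 0"
begin

lemma AE_nonneg: "AE x in M. 0 \<le> x"
  by (rule AE_I[of _ _ "{..<0}"]) (auto simp: negative_null sets_eq)

lemma integrable_bounded:
  fixes f :: "real \<Rightarrow> real"
  assumes f: "f \<in> borel_measurable borel" and B: "\<And>x. 0 \<le> x \<Longrightarrow> \<bar>f x\<bar> \<le> B"
  shows "integrable M f" and "\<bar>LINT x|M. f x\<bar> \<le> B"
proof -
  have [measurable]: "f \<in> borel_measurable M" using f by (simp add: measurable_cong_sets[OF sets_eq refl])
  have ae: "AE x in M. norm (f x) \<le> B" using AE_nonneg by eventually_elim (use B in auto)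
  show i: "integrable M f" by (rule integrable_const_bound[OF ae]) simp
  have "\<bar>LINT x|M. f x\<bar> \<le> (LINT x|M. norm (f x))" using integral_norm_bound[of M f] by simp
  also have "\<dots> \<le> (LINT x|M. B)"
    by (rule integral_mono_AE) (use i ae in auto)
  finally show "\<bar>LINT x|M. f x\<bar> \<le> B" by (simp add: prob_space)
qed

lemma integral_tendsto:
  fixes f :: "nat \<Rightarrow> real \<Rightarrow> real"
  assumes f: "\<And>n. f n \<in> borel_measurable borel" "f' \<in> borel_measurable borel"
    and B: "\<And>n x. 0 \<le> x \<Longrightarrow> \<bar>f n x\<bar> \<le> B" and lim: "\<And>x. 0 \<le> x \<Longrightarrow> (\<lambda>n. f n x) \<longlonglongrightarrow> f' x"
  shows "(\<lambda>n. LINT x|M. f n x) \<longlonglongrightarrow> (LINT x|M. f' x)"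
proof (rule integral_dominated_convergence[where w = "\<lambda>_. B"])
  show "AE x in M. (\<lambda>n. f n x) \<longlonglongrightarrow> f' x" using AE_nonneg by eventually_elim (rule lim)
  show "AE x in M. norm (f n x) \<le> B" for n using AE_nonneg by eventually_elim (use B in auto)
qed (use f in \<open>simp_all add: measurable_cong_sets[OF sets_eq refl]\<close>)

end

lemma cauchy_problem_lawD:
  assumes g: "cauchy_problem_law \<alpha> g"
  shows "0 \<le> t \<Longrightarrow> half_line_law (g t)"
    and "\<phi> \<in> borel_measurable borel \<Longrightarrow> (LINT x|g 0. \<phi> x) = (\<phi> 0 :: real)"
    and "neumann_test_function \<phi> \<Longrightarrow> caputo_differentiable \<alpha> (\<lambda>t. LINT x|g t. \<phi> x)"
    and "neumann_test_function \<phi> \<Longrightarrow> 0 < t \<Longrightarrow>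
           caputo_deriv \<alpha> (\<lambda>t. LINT x|g t. \<phi> x) t = (LINT x|g t. deriv (deriv \<phi>) x)"
    and "neumann_test_function \<phi> \<Longrightarrow> 1 < \<alpha> \<Longrightarrow>
           ((\<lambda>t. LINT x|g t. \<phi> x) has_real_derivative 0) (at 0 within {0..})"
proof -
  note g' = g[unfolded cauchy_problem_law_def Let_def]
  show "0 \<le> t \<Longrightarrow> half_line_law (g t)"
    using g' by (simp add: half_line_law_def half_line_law_axioms_def)
  have "g 0 = return borel 0" using g' by blast
  then show "\<phi> \<in> borel_measurable borel \<Longrightarrow> (LINT x|g 0. \<phi> x) = \<phi> 0"
    by (simp add: integral_return)
qed (use g in \<open>auto simp: cauchy_problem_law_def Let_def\<close>)

lemma borel_measurable_neumann_test_function: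
  assumes "neumann_test_function \<phi>"
  shows "\<phi> \<in> borel_measurable borel" "deriv (deriv \<phi>) \<in> borel_measurable borel"
proof -
  have "continuous_on UNIV \<phi>" "continuous_on UNIV (deriv (deriv \<phi>))"
    using assms unfolding neumann_test_function_def
    by (auto intro!: continuous_at_imp_continuous_on differentiable_imp_continuous_within)
  then show "\<phi> \<in> borel_measurable borel" "deriv (deriv \<phi>) \<in> borel_measurable borel"
    by (auto intro!: borel_measurable_continuous_onI)
qed

text \<open>
  On a test function the weak Cauchy problem is a Caputo equation in time for \<open>\<integral> \<phi> dg\<^sub>t\<close>, whose
  initial value is \<open>\<phi>(0)\<close> because \<open>g\<^sub>0\<close> is the unit mass at 0, and whose initial derivative is 0 if the order
  exceeds 1.
\<close>

lemma integral_exp_law_neumann_test_function: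
  assumes g: "cauchy_problem_law \<alpha> g" and \<alpha>: "0 < \<alpha>" "\<alpha> \<le> 2" and z: "0 < z"
    and \<phi>: "neumann_test_function \<phi>" and B: "\<And>x. 0 \<le> x \<Longrightarrow> \<bar>\<phi> x\<bar> \<le> B" "\<And>x. 0 \<le> x \<Longrightarrow> \<bar>deriv (deriv \<phi>) x\<bar> \<le> B"
  shows "(\<lambda>t. LINT x|g t. \<phi> x) \<in> borel_measurable (restrict_space borel {0<..})"
    and "(\<lambda>t. LINT x|g t. deriv (deriv \<phi>) x) \<in> borel_measurable (restrict_space borel {0<..})"
    and "(LINT t|exp_law z. LINT x|g t. \<phi> x) =
           \<phi> 0 + (LINT t|exp_law z. LINT x|g t. deriv (deriv \<phi>) x) / z powr \<alpha>"
proof -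
  note m = borel_measurable_neumann_test_function[OF \<phi>]
  have b: "\<bar>LINT x|g t. \<phi> x\<bar> \<le> B" "\<bar>LINT x|g t. deriv (deriv \<phi>) x\<bar> \<le> B" if "0 < t" for t
  proof -
    interpret half_line_law "g t" using that by (intro cauchy_problem_lawD(1)[OF g]) simp
    show "\<bar>LINT x|g t. \<phi> x\<bar> \<le> B" "\<bar>LINT x|g t. deriv (deriv \<phi>) x\<bar> \<le> B"
      using integrable_bounded(2) m B by auto
  qed
  note D = cauchy_problem_lawD(3-5)[OF g \<phi>]
  show "(\<lambda>t. LINT x|g t. deriv (deriv \<phi>) x) \<in> borel_measurable (restrict_space borel {0<..})"
    by (rule caputo_inversion(1)[OF \<alpha> D(1) D(3) D(2) b(2)])
  have "continuous_on {0..} (\<lambda>t. LINT x|g t. \<phi> x)"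
    using D(1) unfolding caputo_differentiable_def Let_def by blast
  then show "(\<lambda>t. LINT x|g t. \<phi> x) \<in> borel_measurable (restrict_space borel {0<..})"
    by (intro borel_measurable_continuous_on_restrict) (auto intro: continuous_on_subset)
  show "(LINT t|exp_law z. LINT x|g t. \<phi> x) =
           \<phi> 0 + (LINT t|exp_law z. LINT x|g t. deriv (deriv \<phi>) x) / z powr \<alpha>"
    using integral_exp_law_caputo[OF z \<alpha> D(1) D(3) D(2) b(2) b(1)] cauchy_problem_lawD(2)[OF g m(1)] by simp
qed

lemma integral_exp_law_tendsto:
  fixes f :: "nat \<Rightarrow> real \<Rightarrow> real"
  assumes z: "0 < z" and f: "\<And>n. f n \<in> borel_measurable (restrict_space borel {0<..})"
    and B: "\<And>n t. 0 < t \<Longrightarrow> \<bar>f n t\<bar> \<le> B" and lim: "\<And>t. 0 < t \<Longrightarrow> (\<lambda>n. f n t) \<longlonglongrightarrow> f' t"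
  shows "f' \<in> borel_measurable (restrict_space borel {0<..})"
    and "(\<lambda>n. LINT t|exp_law z. f n t) \<longlonglongrightarrow> (LINT t|exp_law z. f' t)"
proof -
  interpret prob_space "exp_law z" by (rule prob_space_exp_law[OF z])
  show m: "f' \<in> borel_measurable (restrict_space borel {0<..})"
    by (rule borel_measurable_LIMSEQ_real[OF _ f]) (use lim in auto)
  show "(\<lambda>n. LINT t|exp_law z. f n t) \<longlonglongrightarrow> (LINT t|exp_law z. f' t)"
    by (rule integral_dominated_convergence[where w = "\<lambda>_. B"])
       (use B lim in \<open>auto intro!: AE_I2 borel_measurable_exp_law f m\<close>)
qed

text \<open>
  Compact support of the test function is dropped: the cutoffs of \<open>\<phi>\<close> and their second derivatives are
  bounded uniformly in the radius and converge pointwise, so dominated convergence applies first in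
  \<open>x\<close> and then in \<open>t\<close>.
\<close>

lemma integral_exp_law_neumann:
  fixes \<phi> \<phi>' \<phi>'' :: "real \<Rightarrow> real"
  assumes g: "cauchy_problem_law \<alpha> g" and \<alpha>: "0 < \<alpha>" "\<alpha> \<le> 2" and z: "0 < z"
    and d1: "\<And>x. (\<phi> has_real_derivative \<phi>' x) (at x)"
    and d2: "\<And>x. (\<phi>' has_real_derivative \<phi>'' x) (at x)"
    and c: "continuous_on UNIV \<phi>''" and \<phi>0: "\<phi>' 0 = 0"
    and B: "\<And>x. 0 \<le> x \<Longrightarrow> \<bar>\<phi> x\<bar> \<le> B" "\<And>x. 0 \<le> x \<Longrightarrow> \<bar>\<phi>' x\<bar> \<le> B" "\<And>x. 0 \<le> x \<Longrightarrow> \<bar>\<phi>'' x\<bar> \<le> B"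
  shows "(\<lambda>t. LINT x|g t. \<phi> x) \<in> borel_measurable (restrict_space borel {0<..})"
    and "(\<lambda>t. LINT x|g t. \<phi>'' x) \<in> borel_measurable (restrict_space borel {0<..})"
    and "(LINT t|exp_law z. LINT x|g t. \<phi> x) = \<phi> 0 + (LINT t|exp_law z. LINT x|g t. \<phi>'' x) / z powr \<alpha>"
proof -
  define r where "r n = real (Suc n)" for n
  have r: "0 < r n" "1 \<le> r n" for n by (auto simp: r_def)
  define \<psi> where "\<psi> n x = \<phi> x * cutoff (r n) x" for n x
  define \<psi>'' where "\<psi>'' n x = \<phi>'' x * cutoff (r n) x + 2 * \<phi>' x * cutoff' (r n) x + \<phi> x * cutoff'' (r n) x" for n x
  have test: "neumann_test_function (\<psi> n)" and dd: "deriv (deriv (\<psi> n)) = \<psi>'' n" for n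
    using neumann_test_function_mult_cutoff[OF d1 d2 c \<phi>0 r(1)[of n]] by (simp_all add: \<psi>_def[abs_def] \<psi>''_def[abs_def])
  have B0: "0 \<le> B" using B(1)[of 0] by linarith
  (* 43 = 1 + 2 * 6 + 30 comes from the product rule and the bounds 1, 6, 30 on the cutoff and
     its derivatives. *)
  have b: "\<bar>\<psi> n x\<bar> \<le> 43 * B" "\<bar>\<psi>'' n x\<bar> \<le> 43 * B" if "0 \<le> x" for n x
  proof -
    note cb = cutoff_bounds[OF r(2)[of n], of x]
    have 1: "\<bar>\<phi> x * cutoff (r n) x\<bar> \<le> B * 1" "\<bar>\<phi>'' x * cutoff (r n) x\<bar> \<le> B * 1"
      "\<bar>\<phi>' x * cutoff' (r n) x\<bar> \<le> B * 6" "\<bar>\<phi> x * cutoff'' (r n) x\<bar> \<le> B * 30"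
      unfolding abs_mult using cb B[OF that] B0 by (intro mult_mono; simp)+
    show "\<bar>\<psi> n x\<bar> \<le> 43 * B" "\<bar>\<psi>'' n x\<bar> \<le> 43 * B"
      unfolding \<psi>_def \<psi>''_def using 1 B0 by linarith+
  qed
  note T = integral_exp_law_neumann_test_function[OF g \<alpha> z test, where B = "43 * B", unfolded dd, OF b]
  have cont: "continuous_on UNIV \<phi>" using d1 by (auto intro!: continuous_at_imp_continuous_on DERIV_isCont)
  have m: "\<psi> n \<in> borel_measurable borel" "\<psi>'' n \<in> borel_measurable borel" for n
    using borel_measurable_neumann_test_function[OF test[of n]] dd[of n] by auto
  have m': "\<phi> \<in> borel_measurable borel" "\<phi>'' \<in> borel_measurable borel"
    using cont c by (auto intro!: borel_measurable_continuous_onI)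
  have lim: "(\<lambda>n. \<psi> n x) \<longlonglongrightarrow> \<phi> x" "(\<lambda>n. \<psi>'' n x) \<longlonglongrightarrow> \<phi>'' x" for x
  proof -
    have "(\<lambda>n. \<psi> n x) \<longlonglongrightarrow> \<phi> x * 1"
      unfolding \<psi>_def r_def by (intro tendsto_intros cutoff_tendsto)
    then show "(\<lambda>n. \<psi> n x) \<longlonglongrightarrow> \<phi> x" by simp
    have "(\<lambda>n. \<psi>'' n x) \<longlonglongrightarrow> \<phi>'' x * 1 + 2 * \<phi>' x * 0 + \<phi> x * 0"
      unfolding \<psi>''_def r_def by (intro tendsto_intros cutoff_tendsto)
    then show "(\<lambda>n. \<psi>'' n x) \<longlonglongrightarrow> \<phi>'' x" by simp
  qed
  have lim1: "(\<lambda>n. LINT x|g t. \<psi> n x) \<longlonglongrightarrow> (LINT x|g t. \<phi> x)"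
    and lim2: "(\<lambda>n. LINT x|g t. \<psi>'' n x) \<longlonglongrightarrow> (LINT x|g t. \<phi>'' x)"
    and b1: "\<bar>LINT x|g t. \<psi> n x\<bar> \<le> 43 * B" and b2: "\<bar>LINT x|g t. \<psi>'' n x\<bar> \<le> 43 * B" if "0 < t" for t n
  proof -
    interpret half_line_law "g t" using that by (intro cauchy_problem_lawD(1)[OF g]) simp
    show "(\<lambda>n. LINT x|g t. \<psi> n x) \<longlonglongrightarrow> (LINT x|g t. \<phi> x)"
      by (rule integral_tendsto[OF m(1) m'(1) b(1) lim(1)])
    show "(\<lambda>n. LINT x|g t. \<psi>'' n x) \<longlonglongrightarrow> (LINT x|g t. \<phi>'' x)"
      by (rule integral_tendsto[OF m(2) m'(2) b(2) lim(2)])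
    show "\<bar>LINT x|g t. \<psi> n x\<bar> \<le> 43 * B" "\<bar>LINT x|g t. \<psi>'' n x\<bar> \<le> 43 * B"
      using integrable_bounded(2) m b by auto
  qed
  note E1 = integral_exp_law_tendsto[OF z T(1) b1 lim1] and E2 = integral_exp_law_tendsto[OF z T(2) b2 lim2]
  show "(\<lambda>t. LINT x|g t. \<phi> x) \<in> borel_measurable (restrict_space borel {0<..})"
    "(\<lambda>t. LINT x|g t. \<phi>'' x) \<in> borel_measurable (restrict_space borel {0<..})"
    by (rule E1(1) E2(1); assumption)+
  have "(\<lambda>n. \<psi> n 0 + (LINT t|exp_law z. LINT x|g t. \<psi>'' n x) / z powr \<alpha>) \<longlonglongrightarrow>
     (LINT t|exp_law z. LINT x|g t. \<phi> x)"
    using E1(2) by (simp only: T(3))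
  moreover have "(\<lambda>n. \<psi> n 0 + (LINT t|exp_law z. LINT x|g t. \<psi>'' n x) / z powr \<alpha>) \<longlonglongrightarrow>
     \<phi> 0 + (LINT t|exp_law z. LINT x|g t. \<phi>'' x) / z powr \<alpha>"
    by (intro tendsto_intros lim E2(2)) (use z in auto)
  ultimately show "(LINT t|exp_law z. LINT x|g t. \<phi> x) = \<phi> 0 + (LINT t|exp_law z. LINT x|g t. \<phi>'' x) / z powr \<alpha>"
    by (rule LIMSEQ_unique)
qed

text \<open>
  The heart of the proof: the equation of order \<open>2 \<nu>\<close> in time and 2 in space is reduced to its square
  root. Write \<open>a\<close> for \<open>z powr \<nu>\<close>, \<open>D\<close> for the derivative in \<open>x\<close> and \<open>L\<close> for the mean over \<open>x\<close> and then
  over \<open>t\<close>. The transformed Cauchy problem reads \<open>L((a\<^sup>2 - D\<^sup>2) \<phi>) = a\<^sup>2 \<phi>(0)\<close> for bounded \<open>\<phi>\<close> with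
  \<open>\<phi>'(0) = 0\<close>. Given \<open>\<psi>\<close>, solve \<open>(a + D) \<phi> = \<psi>\<close> with \<open>\<phi>(0) = \<psi>(0) / a\<close>, the initial value for which
  the Neumann condition holds. Then \<open>(a\<^sup>2 - D\<^sup>2) \<phi> = (a - D) \<psi>\<close>, so that
  \<open>L((a - D) \<psi>) = a \<psi>(0)\<close> without any boundary condition on \<open>\<psi>\<close>. In other words, the average of \<open>g\<^sub>t\<close>
  over an exponential time of rate \<open>z\<close> is the exponential law of rate \<open>a\<close>.
\<close>

lemma integral_exp_law_resolvent:
  fixes \<psi> \<psi>' :: "real \<Rightarrow> real"
  assumes g: "cauchy_problem_law (2 * \<nu>) g" and \<nu>: "0 < \<nu>" "\<nu> \<le> 1" and z: "0 < z"
    and d: "\<And>x. (\<psi> has_real_derivative \<psi>' x) (at x)" and c: "continuous_on UNIV \<psi>'"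
    and B: "\<And>x. 0 \<le> x \<Longrightarrow> \<bar>\<psi> x\<bar> \<le> B" "\<And>x. 0 \<le> x \<Longrightarrow> \<bar>\<psi>' x\<bar> \<le> B"
  shows "(LINT t|exp_law z. LINT x|g t. z powr \<nu> * \<psi> x - \<psi>' x) = z powr \<nu> * \<psi> 0"
proof -
  define a where "a = z powr \<nu>"
  have a: "0 < a" using z by (simp add: a_def)
  have c\<psi>: "continuous_on UNIV \<psi>"
    using d by (auto intro!: continuous_at_imp_continuous_on DERIV_isCont)
  obtain Q where Q: "\<And>x. (Q has_real_derivative exp (a * x) * \<psi> x) (at x)"
  proof -
    have "\<exists>Q. \<forall>x::real. - \<infinity> < ereal x \<longrightarrow> ereal x < \<infinity> \<longrightarrow> (Q has_vector_derivative exp (a * x) * \<psi> x) (at x)"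
    proof (intro einterval_antiderivative)
      show "isCont (\<lambda>x. exp (a * x) * \<psi> x) x" for x
        by (intro continuous_intros DERIV_isCont[OF d])
    qed simp
    then show ?thesis using that by (auto simp: has_real_derivative_iff_has_vector_derivative)
  qed
  define \<phi> where "\<phi> x = exp (- a * x) * (\<psi> 0 / a + (Q x - Q 0))" for x
  define \<phi>' where "\<phi>' x = \<psi> x - a * \<phi> x" for x
  define \<phi>'' where "\<phi>'' x = \<psi>' x - a * \<phi>' x" for x
  have d1: "(\<phi> has_real_derivative \<phi>' x) (at x)" for x
  proof -
    have "exp (- (a * x)) * exp (a * x) = 1" by (simp add: exp_minus_inverse mult.commute)
    then show ?thesis
      unfolding \<phi>_def[abs_def] \<phi>'_def
      by (auto intro!: derivative_eq_intros Q simp: algebra_simps)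
  qed
  have d2: "(\<phi>' has_real_derivative \<phi>'' x) (at x)" for x
    unfolding \<phi>'_def[abs_def] \<phi>''_def by (auto intro!: derivative_eq_intros d d1 simp: \<phi>'_def)
  have c\<phi>: "continuous_on UNIV \<phi>"
    using d1 by (auto intro!: continuous_at_imp_continuous_on DERIV_isCont)
  have c2: "continuous_on UNIV \<phi>''"
    unfolding \<phi>''_def \<phi>'_def by (intro continuous_intros c c\<psi> c\<phi>)
  have \<phi>0: "\<phi> 0 = \<psi> 0 / a" by (simp add: \<phi>_def)
  have \<phi>'0: "\<phi>' 0 = 0" using a by (simp add: \<phi>'_def \<phi>0)
  (* Both B / a + phi and B / a - phi, multiplied by exp (a x), are nondecreasing and
     nonnegative at 0. *)
  have b0: "\<bar>\<phi> x\<bar> \<le> B / a" if x: "0 \<le> x" for x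
  proof -
    have der: "((\<lambda>x. exp (a * x) * (B / a + s * \<phi> x)) has_real_derivative exp (a * y) * (B + s * \<psi> y)) (at y)" for s y
      using a by (auto intro!: derivative_eq_intros d1 simp: \<phi>'_def field_simps)
    have "0 \<le> B / a + s * \<phi> x" if s: "s = 1 \<or> s = -1" for s
    proof -
      have "0 \<le> B / a + s * \<phi> 0"
        using s B(1)[of 0] a by (auto simp: \<phi>0 field_simps)
      also have "B / a + s * \<phi> 0 \<le> exp (a * x) * (B / a + s * \<phi> x)"
      proof -
        have "exp (a * 0) * (B / a + s * \<phi> 0) \<le> exp (a * x) * (B / a + s * \<phi> x)"
        proof (rule DERIV_nonneg_imp_nondecreasing[OF x])
          fix y assume "0 \<le> y" "y \<le> x"
          then have "0 \<le> exp (a * y) * (B + s * \<psi> y)" using s B(1)[of y] by auto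
          then show "\<exists>u. ((\<lambda>x. exp (a * x) * (B / a + s * \<phi> x)) has_real_derivative u) (at y) \<and> 0 \<le> u"
            using der by blast
        qed
        then show ?thesis by simp
      qed
      finally show ?thesis by (simp add: zero_le_mult_iff)
    qed
    from this[of 1] this[of "-1"] show ?thesis by auto
  qed
  have b1: "\<bar>\<phi>' x\<bar> \<le> 2 * B" if "0 \<le> x" for x
  proof -
    have "\<bar>a * \<phi> x\<bar> \<le> B" using b0[OF that] a by (simp add: abs_mult field_simps)
    then show ?thesis using B(1)[OF that] unfolding \<phi>'_def by linarith
  qed
  have b2: "\<bar>\<phi>'' x\<bar> \<le> B + 2 * a * B" if "0 \<le> x" for x
  proof -
    have "\<bar>a * \<phi>' x\<bar> \<le> a * (2 * B)" unfolding abs_mult using b1[OF that] a by simp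
    then show ?thesis using B(2)[OF that] unfolding \<phi>''_def by linarith
  qed
  have B0: "0 \<le> B" using B(1)[of 0] by linarith
  define D where "D = B / a + 2 * B + B + 2 * a * B"
  have D: "B / a \<le> D" "2 * B \<le> D" "B + 2 * a * B \<le> D"
    using B0 a by (auto simp: D_def)
  have \<alpha>: "0 < 2 * \<nu>" "2 * \<nu> \<le> 2" using \<nu> by auto
  have bD: "\<bar>\<phi> x\<bar> \<le> D" "\<bar>\<phi>' x\<bar> \<le> D" "\<bar>\<phi>'' x\<bar> \<le> D" if "0 \<le> x" for x
    using b0[OF that] b1[OF that] b2[OF that] D by linarith+
  note N = integral_exp_law_neumann[OF g \<alpha> z d1 d2 c2 \<phi>'0 bD]
  have za: "z powr (2 * \<nu>) = a\<^sup>2" using z by (simp add: a_def power2_eq_square powr_add[symmetric])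
  have m: "\<phi> \<in> borel_measurable borel" "\<phi>'' \<in> borel_measurable borel"
    using c\<phi> c2 by (auto intro!: borel_measurable_continuous_onI)
  have in1: "a * \<psi> x - \<psi>' x = a\<^sup>2 * \<phi> x - \<phi>'' x" for x
    by (simp add: \<phi>''_def \<phi>'_def power2_eq_square algebra_simps)
  have eq: "(LINT x|g t. a * \<psi> x - \<psi>' x) = a\<^sup>2 * (LINT x|g t. \<phi> x) - (LINT x|g t. \<phi>'' x)"
    and bR: "\<bar>LINT x|g t. \<phi> x\<bar> \<le> D" "\<bar>LINT x|g t. \<phi>'' x\<bar> \<le> D" if "0 < t" for t
  proof -
    interpret half_line_law "g t" using that by (intro cauchy_problem_lawD(1)[OF g]) simp
    note i = integrable_bounded[OF m(1) bD(1)] integrable_bounded[OF m(2) bD(3)]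
    show "(LINT x|g t. a * \<psi> x - \<psi>' x) = a\<^sup>2 * (LINT x|g t. \<phi> x) - (LINT x|g t. \<phi>'' x)"
      unfolding in1 using i by simp
    show "\<bar>LINT x|g t. \<phi> x\<bar> \<le> D" "\<bar>LINT x|g t. \<phi>'' x\<bar> \<le> D" using i by auto
  qed
  have "(LINT t|exp_law z. LINT x|g t. a * \<psi> x - \<psi>' x) =
      (LINT t|exp_law z. a\<^sup>2 * (LINT x|g t. \<phi> x) - (LINT x|g t. \<phi>'' x))"
    by (rule Bochner_Integration.integral_cong) (auto simp: eq)
  also have "\<dots> = a\<^sup>2 * (LINT t|exp_law z. LINT x|g t. \<phi> x) - (LINT t|exp_law z. LINT x|g t. \<phi>'' x)"
    using integrable_exp_law[OF z N(1) bR(1)] integrable_exp_law[OF z N(2) bR(2)] by simp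
  also have "\<dots> = a\<^sup>2 * \<phi> 0"
    using N(3) a unfolding za by (simp add: field_simps)
  also have "\<dots> = a * \<psi> 0" using a by (simp add: \<phi>0 power2_eq_square)
  finally show ?thesis by (simp add: a_def)
qed

text \<open>
  Continuity in time is part of the Cauchy problem for test functions, and it survives uniform
  approximation on the half line. Replacing \<open>x\<close> by \<open>sqrt (x\<^sup>2 + 1 / r\<^sup>2)\<close> makes any smooth function satisfy the
  Neumann condition and moves the argument by at most \<open>1 / r\<close>; a cutoff then gives compact support.
\<close>

lemma continuous_on_integral_cauchy_problem_law:
  fixes \<psi> \<psi>' \<psi>'' :: "real \<Rightarrow> real"
  assumes g: "cauchy_problem_law \<alpha> g"
    and d1: "\<And>x. (\<psi> has_real_derivative \<psi>' x) (at x)" and d2: "\<And>x. (\<psi>' has_real_derivative \<psi>'' x) (at x)"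
    and c: "continuous_on UNIV \<psi>''"
    and B: "\<And>x. 0 \<le> x \<Longrightarrow> \<bar>\<psi>' x\<bar> \<le> B" and C: "\<And>x. 0 \<le> x \<Longrightarrow> x\<^sup>2 * \<bar>\<psi> x\<bar> \<le> C" and D: "\<And>x. 0 \<le> x \<Longrightarrow> \<bar>\<psi> x\<bar> \<le> D"
  shows "continuous_on {0..} (\<lambda>t. LINT x|g t. \<psi> x)"
proof -
  define s where "s r x = sqrt (x\<^sup>2 + (1 / r)\<^sup>2)" for r x :: real
  define \<phi> where "\<phi> r x = \<psi> (s r x)" for r x
  define F where "F n t = (LINT x|g t. \<phi> (real (Suc n)) x * cutoff (real (Suc n)) x)" for n t
  have s: "0 < s r x" "x \<le> s r x" "s r x \<le> \<bar>x\<bar> + 1 / r" if "0 < r" for r x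
  proof -
    have "0 < x\<^sup>2 + (1 / r)\<^sup>2" using that by (intro add_nonneg_pos) auto
    then show "0 < s r x" by (simp add: s_def)
    show "x \<le> s r x" unfolding s_def by (rule real_le_rsqrt) simp
    have "s r x \<le> sqrt (x\<^sup>2) + sqrt ((1 / r)\<^sup>2)" unfolding s_def by (rule sqrt_add_le_add_sqrt) auto
    then show "s r x \<le> \<bar>x\<bar> + 1 / r" using that by (simp add: real_sqrt_abs)
  qed
  have test: "neumann_test_function (\<lambda>x. \<phi> r x * cutoff r x)" if r: "0 < r" for r
  proof (rule neumann_test_function_mult_cutoff(1)[OF _ _ _ _ r])
    have ds: "(s r has_real_derivative x / s r x) (at x)" for x
      unfolding s_def[abs_def]
      by (rule DERIV_cong[OF DERIV_chain2[OF DERIV_real_sqrt]])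
         (use s(1)[OF r, of x] in \<open>auto simp: s_def field_simps intro!: derivative_eq_intros\<close>)
    show "(\<phi> r has_real_derivative \<psi>' (s r x) * (x / s r x)) (at x)" for x
      unfolding \<phi>_def[abs_def] by (rule DERIV_chain2[OF d1 ds])
    show "((\<lambda>x. \<psi>' (s r x) * (x / s r x)) has_real_derivative
       \<psi>'' (s r x) * (x / s r x) * (x / s r x) + \<psi>' (s r x) * ((s r x - x * (x / s r x)) / (s r x * s r x))) (at x)" for x
    proof -
      have "((\<lambda>x. x / s r x) has_real_derivative (1 * s r x - x * (x / s r x)) / (s r x * s r x)) (at x)"
        by (rule DERIV_divide[OF DERIV_ident ds]) (use s(1)[OF r, of x] in simp)
      from DERIV_mult[OF DERIV_chain2[OF d2 ds] this] show ?thesis by (simp add: algebra_simps)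
    qed
    have cs: "continuous_on UNIV (s r)"
      unfolding s_def[abs_def] by (intro continuous_intros)
    have c': "continuous_on UNIV \<psi>'"
      using d2 by (auto intro!: continuous_at_imp_continuous_on DERIV_isCont)
    have nz: "s r x \<noteq> 0" for x using s(1)[OF r, of x] by simp
    show "continuous_on UNIV (\<lambda>x. \<psi>'' (s r x) * (x / s r x) * (x / s r x) + \<psi>' (s r x) * ((s r x - x * (x / s r x)) / (s r x * s r x)))"
      by (intro continuous_intros cs continuous_on_compose2[OF c cs] continuous_on_compose2[OF c' cs]) (auto simp: nz)
    show "\<psi>' (s r 0) * (0 / s r 0) = 0" by simp
  qed
  have B0: "0 \<le> B" using B[of 0] by linarith
  have close: "\<bar>\<phi> r x * cutoff r x - \<psi> x\<bar> \<le> B / r + 3 * C / r\<^sup>2" if x: "0 \<le> x" and r: "1 \<le> r" for r x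
  proof -
    have r0: "0 < r" using r by simp
    note cb = cutoff_bounds(1,2)[OF r, of x]
    have 1: "\<bar>\<phi> r x - \<psi> x\<bar> \<le> B / r"
    proof (cases "x = s r x")
      case True
      then show ?thesis using B0 r0 by (simp add: \<phi>_def)
    next
      case False
      then have lt: "x < s r x" using s(2)[OF r0, of x] by simp
      obtain y where y: "x < y" "\<psi> (s r x) - \<psi> x = (s r x - x) * \<psi>' y"
        using MVT2[OF lt, of \<psi> \<psi>'] d1 by auto
      have "\<bar>\<psi> (s r x) - \<psi> x\<bar> \<le> (1 / r) * B"
        unfolding y(2) abs_mult using lt s(3)[OF r0, of x] x y(1) B[of y] r0 by (intro mult_mono) auto
      then show ?thesis by (simp add: \<phi>_def)
    qed
    have 2: "\<bar>\<psi> x\<bar> * (1 - cutoff r x) \<le> 3 * C / r\<^sup>2"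
    proof -
      have "\<bar>\<psi> x\<bar> * (1 - cutoff r x) \<le> \<bar>\<psi> x\<bar> * (3 * (x / r)\<^sup>2)"
        by (intro mult_left_mono one_minus_cutoff_le) simp
      also have "\<dots> = 3 * (x\<^sup>2 * \<bar>\<psi> x\<bar>) / r\<^sup>2" by (simp add: power_divide)
      also have "\<dots> \<le> 3 * C / r\<^sup>2" using C[OF x] by (simp add: divide_right_mono)
      finally show ?thesis .
    qed
    have "\<phi> r x * cutoff r x - \<psi> x = (\<phi> r x - \<psi> x) * cutoff r x - \<psi> x * (1 - cutoff r x)"
      by (simp add: algebra_simps)
    also have "\<bar>\<dots>\<bar> \<le> \<bar>\<phi> r x - \<psi> x\<bar> * cutoff r x + \<bar>\<psi> x\<bar> * (1 - cutoff r x)"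
      using cb by (intro order_trans[OF abs_triangle_ineq4]) (simp add: abs_mult)
    also have "\<dots> \<le> B / r * 1 + 3 * C / r\<^sup>2"
      using 1 2 cb B0 r0 by (intro add_mono mult_mono) auto
    finally show ?thesis by simp
  qed
  have m: "\<psi> \<in> borel_measurable borel"
    using d1 by (auto intro!: borel_measurable_continuous_onI continuous_at_imp_continuous_on DERIV_isCont)
  have C0: "0 \<le> C" using C[of 0] by simp
  have diff: "\<bar>F n t - (LINT x|g t. \<psi> x)\<bar> \<le> B / real (Suc n) + 3 * C / (real (Suc n))\<^sup>2" if t: "0 \<le> t" for n t
  proof -
    interpret half_line_law "g t" by (rule cauchy_problem_lawD(1)[OF g t])
    define r where "r = real (Suc n)"
    have r: "1 \<le> r" "0 < r" by (auto simp: r_def)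
    have m2: "(\<lambda>x. \<phi> r x * cutoff r x) \<in> borel_measurable borel"
      by (rule borel_measurable_neumann_test_function(1)[OF test[OF r(2)]])
    have "\<bar>\<phi> r x * cutoff r x\<bar> \<le> D + (B / r + 3 * C / r\<^sup>2)" if "0 \<le> x" for x
      using close[OF that r(1)] D[OF that] by linarith
    note i = integrable_bounded(1)[OF m D] integrable_bounded(1)[OF m2 this]
    have "F n t - (LINT x|g t. \<psi> x) = (LINT x|g t. \<phi> r x * cutoff r x - \<psi> x)"
      unfolding F_def r_def[symmetric] using i by simp
    also have "\<bar>\<dots>\<bar> \<le> B / r + 3 * C / r\<^sup>2"
      by (rule integrable_bounded(2)) (use m m2 close r in auto)
    finally show ?thesis by (simp add: r_def)
  qed
  have "uniform_limit {0..} F (\<lambda>t. LINT x|g t. \<psi> x) sequentially"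
  proof (rule uniform_limitI)
    fix e :: real assume e: "0 < e"
    have "(\<lambda>n. B / real (Suc n) + 3 * C / (real (Suc n))\<^sup>2) \<longlonglongrightarrow> 0" by real_asymp
    then have "\<forall>\<^sub>F n in sequentially. B / real (Suc n) + 3 * C / (real (Suc n))\<^sup>2 < e"
      using e by (rule order_tendstoD(2))
    then show "\<forall>\<^sub>F n in sequentially. \<forall>t\<in>{0..}. dist (F n t) (LINT x|g t. \<psi> x) < e"
      by eventually_elim (use diff in \<open>auto simp: dist_real_def intro: le_less_trans\<close>)
  qed
  moreover have "continuous_on {0..} (F n)" for n
    using cauchy_problem_lawD(3)[OF g test[of "real (Suc n)"]]
    unfolding F_def[abs_def] caputo_differentiable_def Let_def by simp
  ultimately show ?thesis
    by (intro uniform_limit_theorem[of _ F]) auto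
qed

section \<open>The mixture of Yule probabilities is the fractional Yule law\<close>

text \<open>
  The state probabilities of the classical Yule process. At \<open>k = 0\<close> the truncated exponent makes this
  \<open>exp (- lam * x)\<close>, not the probability 0 of that state; with this value the forward equation is an
  identity for every \<open>k\<close>, and at \<open>k = 1\<close> its coefficient \<open>k - 1\<close> removes the term.
\<close>

definition yule_prob :: "real \<Rightarrow> nat \<Rightarrow> real \<Rightarrow> real" where
  "yule_prob lam k x = exp (- lam * x) * (1 - exp (- lam * x)) ^ (k - 1)"

lemma has_real_derivative_yule_prob:
  "(yule_prob lam k has_real_derivative
      - lam * real k * yule_prob lam k x + lam * (real k - 1) * yule_prob lam (k - 1) x) (at x)"
proof (cases "k = 0 \<or> k = 1")
  case True
  then show ?thesis
    unfolding yule_prob_def[abs_def] by (auto intro!: derivative_eq_intros)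
next
  case False
  then obtain m where k: "k = Suc (Suc m)" by (metis One_nat_def not0_implies_Suc)
  show ?thesis
    unfolding yule_prob_def[abs_def] k
    by (rule derivative_eq_intros refl | simp)+ (simp add: algebra_simps)
qed

lemma yule_prob_bounds:
  assumes lam: "0 < lam" and x: "0 \<le> x"
  shows "0 \<le> yule_prob lam k x" "yule_prob lam k x \<le> exp (- lam * x)" "\<bar>yule_prob lam k x\<bar> \<le> 1"
    "x\<^sup>2 * \<bar>yule_prob lam k x\<bar> \<le> 2 / lam\<^sup>2"
proof -
  have u: "0 < exp (- lam * x)" "exp (- lam * x) \<le> 1" using lam x by auto
  show 1: "0 \<le> yule_prob lam k x" unfolding yule_prob_def using u by (intro mult_nonneg_nonneg zero_le_power) auto
  have "exp (- lam * x) * (1 - exp (- lam * x)) ^ (k - 1) \<le> exp (- lam * x) * 1"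
    using u by (intro mult_left_mono power_le_one) auto
  then show 2: "yule_prob lam k x \<le> exp (- lam * x)" by (simp add: yule_prob_def)
  show "\<bar>yule_prob lam k x\<bar> \<le> 1" using 1 2 u by linarith
  have "(lam * x)\<^sup>2 / 2 \<le> exp (lam * x)"
    using exp_lower_Taylor_quadratic[of "lam * x"] lam x mult_nonneg_nonneg[of lam x] by linarith
  then have "(lam * x)\<^sup>2 / 2 * exp (- lam * x) \<le> exp (lam * x) * exp (- lam * x)"
    by (intro mult_right_mono) auto
  then have "lam\<^sup>2 * (x\<^sup>2 * exp (- lam * x)) \<le> 2"
    by (simp add: exp_minus_inverse power_mult_distrib)
  then have "x\<^sup>2 * exp (- lam * x) \<le> 2 / lam\<^sup>2" using lam by (simp add: field_simps)
  moreover have "x\<^sup>2 * \<bar>yule_prob lam k x\<bar> \<le> x\<^sup>2 * exp (- lam * x)"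
    using 1 2 by (intro mult_left_mono) auto
  ultimately show "x\<^sup>2 * \<bar>yule_prob lam k x\<bar> \<le> 2 / lam\<^sup>2" by linarith
qed

text \<open>
  Both sides have the same Laplace transform in \<open>t\<close>. Write \<open>P k\<close> for the classical probabilities and \<open>a\<close>
  for \<open>z powr \<nu>\<close>. For the fractional process the transformed Caputo system is
  \<open>(a + lam k) L(k) = a [k = 1] + lam (k - 1) L(k - 1)\<close>. For the mixture \<open>\<integral> P k dg\<^sub>t\<close> the same recursion comes
  from \<open>L((a - D) (P k)) = a (P k)(0)\<close> and the forward equation
  \<open>D (P k) = - lam k (P k) + lam (k - 1) (P (k - 1))\<close>.
\<close>

lemma fractional_yule_prob_eq:
  assumes lam: "0 < lam" and \<nu>: "0 < \<nu>" "\<nu> \<le> 1" and X: "fractional_yule_process M lam \<nu> X"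
    and g: "cauchy_problem_law (2 * \<nu>) g" and t: "0 < t" and k: "1 \<le> k"
  shows "measure M {\<omega> \<in> space M. X t \<omega> = k} = (LINT x|g t. yule_prob lam k x)"
proof -
  define p where "p k t = measure M {\<omega> \<in> space M. X t \<omega> = k}" for k t
  define R where "R k t = (LINT x|g t. yule_prob lam k x)" for k t
  note X' = X[unfolded fractional_yule_process_def Let_def p_def[symmetric]]
  interpret M: prob_space M using X' by blast
  have p_le: "\<bar>p k t\<bar> \<le> 1" for k t by (simp add: p_def M.prob_le_1)
  have p_0: "p 0 t = 0" if "0 \<le> t" for t
  proof -
    have "{\<omega> \<in> space M. X t \<omega> = 0} = {}" using X' that by force
    then show ?thesis by (simp only: p_def) simp
  qed
  have p_init: "p k 0 = 0 ^ (k - 1)" if "1 \<le> k" for k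
    using X' that by (cases "k = 1") auto
  have p_cap: "caputo_differentiable \<nu> (p k)"
    and p_eq: "0 < t \<Longrightarrow> caputo_deriv \<nu> (p k) t = - lam * real k * p k t + lam * (real k - 1) * p (k - 1) t"
    if "1 \<le> k" for k t
    using X' that unfolding p_def by blast+
  have cp: "continuous_on {0..} (p k)" for k
  proof (cases "k = 0")
    case True
    have "continuous_on {0..} (\<lambda>t. 0 :: real)" by simp
    then show ?thesis
      using True p_0 continuous_on_cong[of "{0..}" "{0..}" "p 0" "\<lambda>t. 0"] by simp
  next
    case False
    then show ?thesis using p_cap[of k] unfolding caputo_differentiable_def Let_def by auto
  qed
  define Y' where "Y' k x = - lam * real k * yule_prob lam k x + lam * (real k - 1) * yule_prob lam (k - 1) x" for k x
  define Y'' where "Y'' k x = - lam * real k * Y' k x + lam * (real k - 1) * Y' (k - 1) x" for k x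
  have dY: "(yule_prob lam k has_real_derivative Y' k x) (at x)" for k x
    unfolding Y'_def by (rule has_real_derivative_yule_prob)
  have dY': "(Y' k has_real_derivative Y'' k x) (at x)" for k x
    unfolding Y'_def[abs_def] Y''_def by (auto intro!: derivative_eq_intros dY simp: Y'_def)
  have cY: "continuous_on UNIV (yule_prob lam k)" "continuous_on UNIV (Y' k)" for k
    using dY dY' by (auto intro!: continuous_at_imp_continuous_on DERIV_isCont)
  have cY'': "continuous_on UNIV (Y'' k)" for k
    unfolding Y''_def[abs_def] by (intro continuous_intros cY)
  have bY: "\<bar>yule_prob lam k x\<bar> \<le> 1" if "0 \<le> x" for k x
    by (rule yule_prob_bounds(3)[OF lam that])
  have bY': "\<bar>Y' k x\<bar> \<le> lam * real k + lam * \<bar>real k - 1\<bar>" if "0 \<le> x" for k x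
  proof -
    have "\<bar>- lam * real k * yule_prob lam k x\<bar> \<le> lam * real k * 1"
      "\<bar>lam * (real k - 1) * yule_prob lam (k - 1) x\<bar> \<le> lam * \<bar>real k - 1\<bar> * 1"
      using lam bY[OF that] by (simp_all add: abs_mult mult_left_le)
    then show ?thesis unfolding Y'_def by linarith
  qed
  have cR: "continuous_on {0..} (R k)" for k
    unfolding R_def[abs_def]
    by (rule continuous_on_integral_cauchy_problem_law[OF g dY dY' cY'' bY' _ bY])
       (use yule_prob_bounds(4)[OF lam] in auto)
  have i: "integrable (g t) (yule_prob lam k)" and R_le: "\<bar>R k t\<bar> \<le> 1" if "0 \<le> t" for k t
  proof -
    interpret half_line_law "g t" by (rule cauchy_problem_lawD(1)[OF g that])
    have "yule_prob lam k \<in> borel_measurable borel" using cY(1) by (rule borel_measurable_continuous_onI)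
    from integrable_bounded[OF this bY] show "integrable (g t) (yule_prob lam k)" "\<bar>R k t\<bar> \<le> 1"
      by (auto simp: R_def)
  qed
  have meas: "f \<in> borel_measurable (restrict_space borel {0<..})" if "continuous_on {0..} f" for f :: "real \<Rightarrow> real"
    by (intro borel_measurable_continuous_on_restrict continuous_on_subset[OF that]) auto
  have L: "(LINT t|exp_law z. p k t) = (LINT t|exp_law z. R k t)" if z: "0 < z" and "1 \<le> k" for z k
    using \<open>1 \<le> k\<close>
  proof (induction k rule: less_induct)
    case (less k)
    define a where "a = z powr \<nu>"
    have a: "0 < a" using z by (simp add: a_def)
    have ip: "integrable (exp_law z) (p k)" and iR: "integrable (exp_law z) (R k)" for k
      by (rule integrable_exp_law[OF z meas, of _ 1]; (intro cp cR p_le R_le; simp)?)+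
    have "(LINT t|exp_law z. p k t) = p k 0 +
        (LINT t|exp_law z. - lam * real k * p k t + lam * (real k - 1) * p (k - 1) t) / a"
      unfolding a_def
    proof (rule integral_exp_law_caputo[OF z \<nu>(1) _ p_cap _ p_eq])
      show "\<bar>- lam * real k * p k t + lam * (real k - 1) * p (k - 1) t\<bar> \<le> lam * real k + lam * \<bar>real k - 1\<bar>" for t
      proof -
        have "\<bar>- lam * real k * p k t\<bar> \<le> lam * real k * 1"
          "\<bar>lam * (real k - 1) * p (k - 1) t\<bar> \<le> lam * \<bar>real k - 1\<bar> * 1"
          using lam p_le by (simp_all add: abs_mult mult_left_le)
        then show ?thesis by linarith
      qed
    qed (use \<nu> less.prems p_le in auto)
    also have "(LINT t|exp_law z. - lam * real k * p k t + lam * (real k - 1) * p (k - 1) t) =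
       - lam * real k * (LINT t|exp_law z. p k t) + lam * (real k - 1) * (LINT t|exp_law z. p (k - 1) t)"
      using ip by simp
    finally have 1: "(a + lam * real k) * (LINT t|exp_law z. p k t) =
        a * p k 0 + lam * (real k - 1) * (LINT t|exp_law z. p (k - 1) t)"
      using a by (simp add: field_simps)
    have b0: "0 \<le> lam * real k + lam * \<bar>real k - 1\<bar>" using lam by simp
    have bb: "\<bar>yule_prob lam k x\<bar> \<le> 1 + (lam * real k + lam * \<bar>real k - 1\<bar>)"
      "\<bar>Y' k x\<bar> \<le> 1 + (lam * real k + lam * \<bar>real k - 1\<bar>)" if "0 \<le> x" for x
      using bY[OF that, of k] bY'[OF that, of k] b0 by linarith+
    have "(LINT t|exp_law z. LINT x|g t. a * yule_prob lam k x - Y' k x) = a * yule_prob lam k 0"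
      unfolding a_def
      by (rule integral_exp_law_resolvent[OF g \<nu> z dY cY(2) bb])
    also have "(LINT t|exp_law z. LINT x|g t. a * yule_prob lam k x - Y' k x) =
       (LINT t|exp_law z. (a + lam * real k) * R k t - lam * (real k - 1) * R (k - 1) t)"
    proof (rule Bochner_Integration.integral_cong[OF refl])
      fix t assume "t \<in> space (exp_law z)"
      then have "0 \<le> t" by simp
      note i = i[OF this]
      have "(LINT x|g t. a * yule_prob lam k x - Y' k x) =
        (LINT x|g t. (a + lam * real k) * yule_prob lam k x - lam * (real k - 1) * yule_prob lam (k - 1) x)"
        by (simp add: Y'_def algebra_simps)
      also have "\<dots> = (a + lam * real k) * R k t - lam * (real k - 1) * R (k - 1) t"
        unfolding R_def using i by simp
      finally show "(LINT x|g t. a * yule_prob lam k x - Y' k x) = (a + lam * real k) * R k t - lam * (real k - 1) * R (k - 1) t" .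
    qed
    also have "\<dots> = (a + lam * real k) * (LINT t|exp_law z. R k t) - lam * (real k - 1) * (LINT t|exp_law z. R (k - 1) t)"
      using iR by simp
    finally have 2: "(a + lam * real k) * (LINT t|exp_law z. R k t) =
        a * p k 0 + lam * (real k - 1) * (LINT t|exp_law z. R (k - 1) t)"
      using p_init[OF less.prems] by (simp add: yule_prob_def)
    have "(real k - 1) * (LINT t|exp_law z. p (k - 1) t) = (real k - 1) * (LINT t|exp_law z. R (k - 1) t)"
      using less.IH[of "k - 1"] less.prems by (cases "k = 1") auto
    then have "(a + lam * real k) * (LINT t|exp_law z. p k t) = (a + lam * real k) * (LINT t|exp_law z. R k t)"
      using 1 2 by (simp add: mult.assoc)
    moreover have "a + lam * real k \<noteq> 0" using a lam by (smt (verit) mult_nonneg_nonneg of_nat_0_le_iff)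
    ultimately show ?case by simp
  qed
  have "p k t - R k t = 0"
  proof (rule exp_law_integral_unique[OF _ _ _ t])
    show "continuous_on {0..} (\<lambda>t. p k t - R k t)" by (intro continuous_intros cp cR)
    show "\<bar>p k t - R k t\<bar> \<le> 2" if "0 \<le> t" for t using p_le[of k t] R_le[OF that, of k] by linarith
    fix z :: real assume z: "0 < z"
    have "integrable (exp_law z) (p k)" "integrable (exp_law z) (R k)"
      by (rule integrable_exp_law[OF z meas, of _ 1]; (intro cp cR p_le R_le; simp)?)+
    then show "(LINT t|exp_law z. p k t - R k t) = 0" using L[OF z k] by simp
  qed
  then show ?thesis by (simp add: p_def R_def)
qed

section \<open>Marginals of the classical Yule process\<close>

lemma pure_birth_processD:
  assumes N: "pure_birth_process M b i N"
  shows "prob_space M" and "0 \<le> t \<Longrightarrow> N t \<in> measurable M (count_space UNIV)"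
    and "\<omega> \<in> space M \<Longrightarrow> N 0 \<omega> = i" and "\<omega> \<in> space M \<Longrightarrow> mono_on {0..} (\<lambda>t. N t \<omega>)"
    and "\<omega> \<in> space M \<Longrightarrow> 0 \<le> t \<Longrightarrow> continuous (at_right t) (\<lambda>s. N s \<omega>)"
proof -
  note D = N[unfolded pure_birth_process_def]
  note path = D[THEN conjunct2, THEN conjunct2, THEN conjunct1, THEN bspec]
  show "prob_space M" by (rule D[THEN conjunct1])
  show "0 \<le> t \<Longrightarrow> N t \<in> measurable M (count_space UNIV)"
    by (rule D[THEN conjunct2, THEN conjunct1, rule_format])
  show "\<omega> \<in> space M \<Longrightarrow> N 0 \<omega> = i" by (rule path[THEN conjunct1])
  show "\<omega> \<in> space M \<Longrightarrow> mono_on {0..} (\<lambda>t. N t \<omega>)"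
    by (rule path[THEN conjunct2, THEN conjunct1])
  show "\<omega> \<in> space M \<Longrightarrow> 0 \<le> t \<Longrightarrow> continuous (at_right t) (\<lambda>s. N s \<omega>)"
    by (rule path[THEN conjunct2, THEN conjunct2, rule_format])
qed

text \<open>
  Kolmogorov's forward equation. Since paths are nondecreasing, the Chapman--Kolmogorov sum for the
  step from \<open>t\<close> to \<open>t + h\<close> is finite, and the generator is the derivative of each transition probability
  at 0. This yields the derivative from the right. The derivative from the left uses the same sum from \<open>t - h\<close>
  to \<open>t\<close>, whose weights at time \<open>t - h\<close> converge because the increments of the transition probabilities bound
  those of the state probabilities.
\<close>

lemma pure_birth_process_forward:
  assumes N: "pure_birth_process M b i N" and t: "0 \<le> t"
  shows "((\<lambda>t. measure M {\<omega> \<in> space M. N t \<omega> = k}) has_real_derivative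
           (\<Sum>j\<le>k. measure M {\<omega> \<in> space M. N t \<omega> = j} * birth_generator b j k)) (at t within {0..})"
proof -
  define p where "p k t = measure M {\<omega> \<in> space M. N t \<omega> = k}" for k t
  interpret prob_space M by (rule pure_birth_processD(1)[OF N])
  obtain P where P0': "\<forall>j k. P j k 0 = (if j = k then 1 else 0)"
    and dP': "\<forall>j k. (P j k has_real_derivative birth_generator b j k) (at 0 within {0..})"
    and fdd': "\<forall>(n::nat) (t :: nat \<Rightarrow> real) (k :: nat \<Rightarrow> nat). 0 \<le> t 0 \<and> (\<forall>m<n. t m \<le> t (Suc m)) \<longrightarrow>
       measure M {\<omega> \<in> space M. \<forall>m\<le>n. N (t m) \<omega> = k m} =
             P i (k 0) (t 0) * (\<Prod>m<n. P (k m) (k (Suc m)) (t (Suc m) - t m))"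
    using N unfolding pure_birth_process_def by (elim conjE exE)
  note P0 = P0'[rule_format] and dP = dP'[rule_format]
  have fdd: "measure M {\<omega> \<in> space M. \<forall>m\<le>n. N (t m) \<omega> = k m} =
      P i (k 0) (t 0) * (\<Prod>m<n. P (k m) (k (Suc m)) (t (Suc m) - t m))"
    if "0 \<le> t 0" "\<And>m. m < n \<Longrightarrow> t m \<le> t (Suc m)" for n :: nat and t k
    by (rule fdd'[rule_format], rule conjI) (use that in auto)
  have mN: "N t \<in> measurable M (count_space UNIV)" if "0 \<le> t" for t
    by (rule pure_birth_processD(2)[OF N that])
  have mono: "N s \<omega> \<le> N t \<omega>" if "0 \<le> s" "s \<le> t" "\<omega> \<in> space M" for s t \<omega>
    using mono_onD[OF pure_birth_processD(4)[OF N that(3)], of s t] that by simp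
  have p_le: "0 \<le> p k t" "p k t \<le> 1" for k t by (simp_all add: p_def)
  have pP: "p k t = P i k t" if "0 \<le> t" for k t
    using fdd[of "\<lambda>_. t" 0 "\<lambda>_. k"] that by (simp add: p_def)
  have le1: "(\<forall>m\<le>1. Q m) \<longleftrightarrow> Q 0 \<and> Q 1" for Q :: "nat \<Rightarrow> bool"
    by (metis le_eq_less_or_eq less_one zero_le_one order_refl)
  have joint: "measure M {\<omega> \<in> space M. N t \<omega> = j \<and> N (t + h) \<omega> = k} = p j t * P j k h" if "0 \<le> t" "0 \<le> h" for t h j k
  proof -
    have "{\<omega> \<in> space M. \<forall>m\<le>1::nat. N (if m = 0 then t else t + h) \<omega> = (if m = 0 then j else k)} =
       {\<omega> \<in> space M. N t \<omega> = j \<and> N (t + h) \<omega> = k}"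
      by (simp only: le1 simp_thms if_True if_False one_neq_zero)
    moreover have "measure M {\<omega> \<in> space M. \<forall>m\<le>1::nat. N (if m = 0 then t else t + h) \<omega> = (if m = 0 then j else k)} = P i j t * P j k h"
      using fdd[of "\<lambda>m. if m = 0 then t else t + h" 1 "\<lambda>m. if m = 0 then j else k"] that
      by simp
    ultimately show ?thesis using that by (simp add: pP)
  qed
  have CK: "p k (t + h) = (\<Sum>j\<le>k. p j t * P j k h)" if "0 \<le> t" "0 \<le> h" for t h k
  proof -
    define A where "A j = {\<omega> \<in> space M. N t \<omega> = j \<and> N (t + h) \<omega> = k}" for j
    have "{\<omega> \<in> space M. N (t + h) \<omega> = k} = (\<Union>j\<le>k. A j)"
      using mono[of t "t + h"] that by (auto simp: A_def)
    then have "p k (t + h) = measure M (\<Union>j\<in>{..k}. A j)" by (simp add: p_def)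
    also have "\<dots> = (\<Sum>j\<le>k. measure M (A j))"
    proof (rule finite_measure_finite_Union)
      have [measurable]: "N t \<in> measurable M (count_space UNIV)" "N (t + h) \<in> measurable M (count_space UNIV)"
        using mN that by auto
      show "A ` {..k} \<subseteq> sets M" unfolding A_def by auto
      show "disjoint_family_on A {..k}" by (auto simp: disjoint_family_on_def A_def)
    qed simp
    finally show ?thesis using joint[OF that] by (simp add: A_def)
  qed
  have incr: "p k (t + h) - p k t = (\<Sum>j\<le>k. p j t * (P j k h - P j k 0))" if "0 \<le> t" "0 \<le> h" for t h k
  proof -
    have "(\<Sum>j\<le>k. p j t * P j k 0) = (\<Sum>j\<le>k. if j = k then p j t else 0)"
      by (intro sum.cong) (auto simp: P0)
    also have "\<dots> = p k t" by simp
    finally show ?thesis by (simp add: CK[OF that] right_diff_distrib sum_subtractf)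
  qed
  have dq: "((\<lambda>h. (P j k h - P j k 0) / h) \<longlongrightarrow> birth_generator b j k) (at_right 0)" for j k
    using dP[of j k] by (simp add: has_field_derivative_iff at_within_Ici_at_right)
  have P_cont: "((\<lambda>h. P j k h - P j k 0) \<longlongrightarrow> 0) (at_right 0)" for j k
  proof -
    have "((\<lambda>h. (P j k h - P j k 0) / h * h) \<longlongrightarrow> birth_generator b j k * 0) (at_right 0)"
      by (intro tendsto_intros dq)
    moreover have "\<forall>\<^sub>F h in at_right (0::real). (P j k h - P j k 0) / h * h = P j k h - P j k 0"
      by (auto simp: eventually_at_filter)
    ultimately show ?thesis by (simp add: filterlim_cong[OF refl refl])
  qed
  have right: "((\<lambda>y. (p k y - p k t) / (y - t)) \<longlongrightarrow> (\<Sum>j\<le>k. p j t * birth_generator b j k)) (at_right t)"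
    unfolding filterlim_at_right_to_0[of _ _ t]
  proof (rule Lim_transform_eventually)
    show "((\<lambda>h. \<Sum>j\<le>k. p j t * ((P j k h - P j k 0) / h)) \<longlongrightarrow> (\<Sum>j\<le>k. p j t * birth_generator b j k)) (at_right 0)"
      by (intro tendsto_intros dq)
    show "\<forall>\<^sub>F h in at_right 0. (\<Sum>j\<le>k. p j t * ((P j k h - P j k 0) / h)) = (p k (h + t) - p k t) / (h + t - t)"
      using eventually_at_right_less[of "0::real"]
    proof eventually_elim
      case (elim h)
      then show ?case using incr[OF t, of h k] by (simp add: add.commute sum_divide_distrib)
    qed
  qed
  have "((\<lambda>y. (p k y - p k t) / (y - t)) \<longlongrightarrow> (\<Sum>j\<le>k. p j t * birth_generator b j k)) (at t within {0..})"
  proof (cases "t = 0")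
    case True
    then show ?thesis using right by (simp add: at_within_Ici_at_right)
  next
    case False
    with t have t: "0 < t" by simp
    have small: "\<forall>\<^sub>F h in at_right 0. 0 < h \<and> h < t"
      using eventually_at_right_real[OF t] by eventually_elim auto
    have left_cont: "((\<lambda>h. p j (t - h)) \<longlongrightarrow> p j t) (at_right 0)" for j
    proof -
      have "((\<lambda>h. p j t - p j (t - h)) \<longlongrightarrow> 0) (at_right 0)"
      proof (rule Lim_null_comparison)
        show "((\<lambda>h. \<Sum>l\<le>j. \<bar>P l j h - P l j 0\<bar>) \<longlongrightarrow> 0) (at_right 0)"
          using tendsto_sum[of "{..j}" "\<lambda>l h. \<bar>P l j h - P l j 0\<bar>" "\<lambda>_. 0"] tendsto_rabs_zero[OF P_cont] by simp
        show "\<forall>\<^sub>F h in at_right 0. norm (p j t - p j (t - h)) \<le> (\<Sum>l\<le>j. \<bar>P l j h - P l j 0\<bar>)"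
          using small
        proof eventually_elim
          case (elim h)
          have "\<bar>p j t - p j (t - h)\<bar> \<le> (\<Sum>l\<le>j. \<bar>p l (t - h) * (P l j h - P l j 0)\<bar>)"
            using incr[of "t - h" h j] elim by (simp add: sum_abs)
          also have "\<dots> \<le> (\<Sum>l\<le>j. \<bar>P l j h - P l j 0\<bar>)"
            by (intro sum_mono) (simp add: abs_mult p_le mult_left_le_one_le)
          finally show ?case by simp
        qed
      qed
      from tendsto_diff[OF tendsto_const this, of "p j t"] show ?thesis by simp
    qed
    have "((\<lambda>y. (p k y - p k t) / (y - t)) \<longlongrightarrow> (\<Sum>j\<le>k. p j t * birth_generator b j k)) (at_left t)"
      unfolding filterlim_at_left_to_right filterlim_at_right_to_0[of _ _ "- t"]
    proof (rule Lim_transform_eventually)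
      show "((\<lambda>h. \<Sum>j\<le>k. p j (t - h) * ((P j k h - P j k 0) / h)) \<longlongrightarrow> (\<Sum>j\<le>k. p j t * birth_generator b j k)) (at_right 0)"
        by (intro tendsto_intros dq left_cont)
      show "\<forall>\<^sub>F h in at_right 0. (\<Sum>j\<le>k. p j (t - h) * ((P j k h - P j k 0) / h)) =
          (p k (- (h + - t)) - p k t) / (- (h + - t) - t)"
        using small
      proof eventually_elim
        case (elim h)
        have "(\<Sum>j\<le>k. p j (t - h) * ((P j k h - P j k 0) / h)) = (p k t - p k (t - h)) / h"
          using incr[of "t - h" h k] elim by (simp add: sum_divide_distrib)
        also have "\<dots> = (p k (t - h) - p k t) / (- h)" by (simp add: minus_divide_left)
        finally show ?case by simp
      qed
    qed
    with right have "((\<lambda>y. (p k y - p k t) / (y - t)) \<longlongrightarrow> (\<Sum>j\<le>k. p j t * birth_generator b j k)) (at t)"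
      by (intro filterlim_split_at)
    then show ?thesis by (rule tendsto_mono[OF at_le[OF subset_UNIV]])
  qed
  then show ?thesis by (simp add: has_field_derivative_iff p_def)
qed

text \<open>
  The forward equations determine the state probabilities one after the other; the integrating factor
  \<open>exp (lam k t)\<close> shows that the difference from the geometric law is constant, hence 0.
\<close>

lemma yule_process_prob:
  assumes N: "yule_process M lam N" and t: "0 \<le> t" and k: "1 \<le> k"
  shows "measure M {\<omega> \<in> space M. N t \<omega> = k} = yule_prob lam k t"
  using k t
proof (induction k arbitrary: t rule: less_induct)
  case (less k)
  define p where "p k t = measure M {\<omega> \<in> space M. N t \<omega> = k}" for k t
  have N': "pure_birth_process M (\<lambda>k. lam * real k) 1 N" using N by (simp add: yule_process_def)
  interpret prob_space M by (rule pure_birth_processD(1)[OF N'])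
  have p_init: "p j 0 = (if j = 1 then 1 else 0)" for j
  proof -
    have "{\<omega> \<in> space M. N 0 \<omega> = j} = (if j = 1 then space M else {})"
      using pure_birth_processD(3)[OF N'] by auto
    then show ?thesis by (simp add: p_def prob_space)
  qed
  have dp: "(p k has_real_derivative - lam * real k * p k t + lam * (real k - 1) * p (k - 1) t) (at t within {0..})"
    if "0 \<le> t" for t
  proof -
    obtain m where m: "k = Suc m" using less.prems(1) by (cases k) auto
    have "(\<Sum>j\<le>m. p j t * birth_generator (\<lambda>k. lam * real k) j k) = (\<Sum>j\<le>m. if j = m then p j t * (lam * real j) else 0)"
      by (intro sum.cong) (auto simp: birth_generator_def m)
    then have "(\<Sum>j\<le>k. p j t * birth_generator (\<lambda>k. lam * real k) j k) =
        - lam * real k * p k t + lam * (real k - 1) * p (k - 1) t"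
      by (simp add: m birth_generator_def)
    moreover have "(p k has_real_derivative (\<Sum>j\<le>k. p j t * birth_generator (\<lambda>k. lam * real k) j k)) (at t within {0..})"
      unfolding p_def[abs_def] by (rule pure_birth_process_forward[OF N' that])
    ultimately show ?thesis by (simp only:)
  qed
  define u where "u t = exp (lam * real k * t) * (p k t - yule_prob lam k t)" for t
  have "(u has_real_derivative 0) (at t within {0..})" if "t \<in> {0..}" for t
  proof -
    have t: "0 \<le> t" using that by simp
    have eq: "(real k - 1) * p (k - 1) t = (real k - 1) * yule_prob lam (k - 1) t"
      using less.IH[of "k - 1" t] less.prems(1) t by (cases "k = 1") (auto simp: p_def)
    have "(u has_real_derivative exp (lam * real k * t) * (lam * ((real k - 1) * p (k - 1) t - (real k - 1) * yule_prob lam (k - 1) t))) (at t within {0..})"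
      unfolding u_def[abs_def]
      by (auto intro!: derivative_eq_intros dp[OF t] has_real_derivative_yule_prob[THEN has_field_derivative_at_within] simp: algebra_simps)
    then show ?thesis by (simp only: eq diff_self mult_zero_right)
  qed
  then obtain c where c: "\<And>t. 0 \<le> t \<Longrightarrow> u t = c"
    using has_field_derivative_zero_constant[of "{0::real..}" u] by auto
  have "u 0 = 0" using less.prems(1) by (auto simp: u_def p_init yule_prob_def)
  then have "u t = 0" using c[of 0] c[OF less.prems(2)] by simp
  then show ?case by (simp add: u_def p_def)
qed

lemma yule_process_ge_1:
  assumes N: "yule_process M lam N" and t: "0 \<le> t" and \<omega>: "\<omega> \<in> space M"
  shows "1 \<le> N t \<omega>"
proof -
  note D = pure_birth_processD[OF N[unfolded yule_process_def]]
  show ?thesis using D(3,4)[OF \<omega>] using mono_onD[of "{0..}" "\<lambda>t. N t \<omega>" 0 t] t by simp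
qed

section \<open>A process at an independent random time\<close>

lemma indep_of_process_prob:
  assumes M: "prob_space M" and N: "\<And>t. 0 \<le> t \<Longrightarrow> N t \<in> measurable M (count_space UNIV)"
    and ind: "indep_of_process M T N" and B: "B \<in> sets borel" and s: "0 \<le> s"
  shows "measure M ((T -` B \<inter> space M) \<inter> {\<omega> \<in> space M. N s \<omega> = k}) =
    measure M (T -` B \<inter> space M) * measure M {\<omega> \<in> space M. N s \<omega> = k}"
proof -
  interpret prob_space M by (rule M)
  define F where "F = (\<lambda>\<omega>. \<lambda>s\<in>{0..}. N s \<omega>)"
  have F: "F \<in> space M \<rightarrow> space (Pi\<^sub>M {0..} (\<lambda>_. count_space UNIV))"
    by (auto simp: F_def space_PiM)
  have 1: "T -` B \<inter> space M \<in> sets (vimage_algebra (space M) T borel)"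
    by (rule in_vimage_algebra[OF B])
  define C where "C = {f \<in> space (Pi\<^sub>M {0..} (\<lambda>_. count_space (UNIV :: nat set))). f s = k}"
  have "C \<in> sets (Pi\<^sub>M {0..} (\<lambda>_. count_space UNIV))"
  proof -
    have [measurable]: "(\<lambda>f. f s) \<in> measurable (Pi\<^sub>M {0..} (\<lambda>_. count_space (UNIV :: nat set))) (count_space UNIV)"
      by (rule measurable_component_singleton) (use s in simp)
    show ?thesis unfolding C_def by measurable
  qed
  from in_vimage_algebra[OF this, of F "space M"]
  have "F -` C \<inter> space M \<in> sets (vimage_algebra (space M) F (Pi\<^sub>M {0..} (\<lambda>_. count_space UNIV)))" .
  moreover have "F -` C \<inter> space M = {\<omega> \<in> space M. N s \<omega> = k}"
    using F s by (auto simp: C_def F_def)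
  ultimately show ?thesis
    using indep_setD[OF ind[unfolded indep_of_process_def] 1] by (simp add: F_def)
qed

text \<open>
  Evaluation of a path at a time, as a function of both, is not measurable for the product
  sigma-algebra of the path space; so the law of
  \<open>N (T \<omega>) \<omega>\<close> is obtained by discretisation. \<open>T\<close> is replaced by the next larger point \<open>U n\<close> of a grid of
  mesh \<open>1 / (n + 1)\<close>. On the event that \<open>U n\<close> is a given grid point only one variable of the process
  matters, and independence applies. Since \<open>U n > T\<close> and the paths are right continuous with discrete
  values, \<open>N (U n \<omega>) \<omega>\<close> is eventually equal to \<open>N (T \<omega>) \<omega>\<close>.
\<close>

lemma subordinated_process_prob:
  fixes N :: "real \<Rightarrow> 'a \<Rightarrow> nat"
  assumes M: "prob_space M" and N: "\<And>t. 0 \<le> t \<Longrightarrow> N t \<in> measurable M (count_space UNIV)"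
    and rc: "\<And>\<omega> t. \<omega> \<in> space M \<Longrightarrow> 0 \<le> t \<Longrightarrow> continuous (at_right t) (\<lambda>s. N s \<omega>)"
    and T: "T \<in> borel_measurable M" "\<And>\<omega>. \<omega> \<in> space M \<Longrightarrow> 0 \<le> T \<omega>"
    and ind: "indep_of_process M T N"
    and q: "\<And>t. 0 \<le> t \<Longrightarrow> measure M {\<omega> \<in> space M. N t \<omega> = k} = q t" and cq: "continuous_on UNIV q"
  shows "{\<omega> \<in> space M. N (T \<omega>) \<omega> = k} \<in> sets M"
    and "measure M {\<omega> \<in> space M. N (T \<omega>) \<omega> = k} = (LINT \<omega>|M. q (T \<omega>))"
proof -
  interpret prob_space M by (rule M)
  note [measurable] = T(1)
  define S where "S n j = real (Suc j) / real (Suc n)" for n j :: nat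
  define B where "B n j = {x::real. nat \<lfloor>real (Suc n) * x\<rfloor> = j}" for n j :: nat
  (* U n \<omega> = S n (m n \<omega>) is the grid point strictly above T \<omega>; the
     successor in S makes it strict even when T \<omega> lies on the grid. *)
  define m where "m n \<omega> = nat \<lfloor>real (Suc n) * T \<omega>\<rfloor>" for n \<omega>
  define U where "U n \<omega> = S n (m n \<omega>)" for n \<omega>
  define A where "A n = {\<omega> \<in> space M. N (U n \<omega>) \<omega> = k}" for n
  define E where "E n j = (T -` B n j \<inter> space M) \<inter> {\<omega> \<in> space M. N (S n j) \<omega> = k}" for n j
  have S: "0 \<le> S n j" for n j by (simp add: S_def)
  have B: "B n j \<in> sets borel" for n j unfolding B_def by measurable
  have mem: "\<omega> \<in> T -` B n j \<inter> space M \<longleftrightarrow> \<omega> \<in> space M \<and> m n \<omega> = j" for n j \<omega>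
    by (auto simp: B_def m_def)
  have TB: "T -` B n j \<inter> space M \<in> sets M" for n j using B T(1) by (rule measurable_sets[rotated])
  have NS: "{\<omega> \<in> space M. N (S n j) \<omega> = k} \<in> sets M" for n j
    using N[OF S[of n j]] by measurable
  have E: "E n j \<in> sets M" for n j unfolding E_def using TB NS by auto
  have q01: "0 \<le> q t" "q t \<le> 1" if "0 \<le> t" for t using q[OF that, symmetric] by auto
  have "\<omega> \<in> E n j \<longleftrightarrow> \<omega> \<in> space M \<and> m n \<omega> = j \<and> N (S n j) \<omega> = k" for n j \<omega>
    unfolding E_def using mem by blast
  then have A_E: "A n = (\<Union>j. E n j)" for n
    by (auto simp: A_def U_def)
  have A: "A n \<in> sets M" for n unfolding A_E using E by auto
  have disj: "disjoint_family (\<lambda>j. T -` B n j \<inter> space M)" for n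
    unfolding disjoint_family_on_def by (intro ballI impI equals0I) (metis IntE mem)
  have disjE: "disjoint_family (E n)" for n
    using disj[of n] unfolding disjoint_family_on_def E_def by blast
  have [measurable]: "q \<in> borel_measurable borel" using cq by (rule borel_measurable_continuous_onI)
  have mU: "U n \<in> borel_measurable M" for n unfolding U_def m_def S_def by measurable
  have U: "T \<omega> < U n \<omega>" "U n \<omega> \<le> T \<omega> + 1 / real (Suc n)" if "\<omega> \<in> space M" for n \<omega>
  proof -
    have t: "0 \<le> real (Suc n) * T \<omega>" using T(2)[OF that] by simp
    then have m: "real (m n \<omega>) = of_int \<lfloor>real (Suc n) * T \<omega>\<rfloor>" unfolding m_def by simp
    have "real (Suc n) * T \<omega> < real (Suc (m n \<omega>))" using m by linarith
    then show "T \<omega> < U n \<omega>" by (simp add: U_def S_def field_simps)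
    have "real (Suc (m n \<omega>)) \<le> real (Suc n) * T \<omega> + 1" using m by linarith
    then have "U n \<omega> \<le> (real (Suc n) * T \<omega> + 1) / real (Suc n)"
      unfolding U_def S_def by (rule divide_right_mono) simp
    also have "\<dots> = T \<omega> + 1 / real (Suc n)"
      by (simp add: add_divide_distrib del: of_nat_Suc)
    finally show "U n \<omega> \<le> T \<omega> + 1 / real (Suc n)" .
  qed
  have step: "measure M (A n) = (LINT \<omega>|M. q (U n \<omega>))" for n
  proof -
    have "emeasure M (A n) = (\<Sum>j. emeasure M (E n j))"
      unfolding A_E by (rule suminf_emeasure[symmetric]) (use E disjE in auto)
    also have "\<dots> = (\<Sum>j. \<integral>\<^sup>+\<omega>. ennreal (q (S n j)) * indicator (T -` B n j \<inter> space M) \<omega> \<partial>M)"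
    proof (rule suminf_cong)
      fix j
      have "measure M (E n j) = measure M (T -` B n j \<inter> space M) * q (S n j)"
        using indep_of_process_prob[OF M N ind B S] q[OF S] by (simp add: E_def)
      then show "emeasure M (E n j) = (\<integral>\<^sup>+\<omega>. ennreal (q (S n j)) * indicator (T -` B n j \<inter> space M) \<omega> \<partial>M)"
        using TB[of n j] q01[OF S, of n j] by (simp add: nn_integral_cmult_indicator emeasure_eq_measure ennreal_mult'' mult.commute ennreal_mult')
    qed
    also have "\<dots> = (\<integral>\<^sup>+\<omega>. (\<Sum>j. ennreal (q (S n j)) * indicator (T -` B n j \<inter> space M) \<omega>) \<partial>M)"
      using TB by (intro nn_integral_suminf[symmetric]) auto
    also have "\<dots> = (\<integral>\<^sup>+\<omega>. ennreal (q (U n \<omega>)) \<partial>M)"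
    proof (rule nn_integral_cong)
      fix \<omega> assume "\<omega> \<in> space M"
      then have "\<omega> \<in> T -` B n (m n \<omega>) \<inter> space M" by (simp only: mem)
      from suminf_cmult_indicator[OF disj this]
      show "(\<Sum>j. ennreal (q (S n j)) * indicator (T -` B n j \<inter> space M) \<omega>) = ennreal (q (U n \<omega>))"
        by (simp add: U_def)
    qed
    also have "\<dots> = ennreal (LINT \<omega>|M. q (U n \<omega>))"
    proof (rule nn_integral_eq_integral)
      have "0 \<le> U n \<omega>" for \<omega> by (simp add: U_def S)
      note b = q01[OF this]
      show "integrable M (\<lambda>\<omega>. q (U n \<omega>))"
        by (rule integrable_const_bound[where B = 1]) (use b mU in auto)
      show "AE \<omega> in M. 0 \<le> q (U n \<omega>)" using b by simp
    qed
    finally show ?thesis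
      by (simp add: emeasure_eq_measure ennreal_inj Bochner_Integration.integral_nonneg q01 U_def S)
  qed
  have U0: "0 \<le> U n \<omega>" for n \<omega> by (simp add: U_def S)
  have mqU: "(\<lambda>\<omega>. q (U n \<omega>)) \<in> borel_measurable M" for n using mU[of n] by measurable
  define I where "I \<omega> = (if N (T \<omega>) \<omega> = k then 1 else 0 :: real)" for \<omega>
  have lim: "(\<lambda>n. indicator (A n) \<omega>) \<longlonglongrightarrow> I \<omega>" and limU: "(\<lambda>n. q (U n \<omega>)) \<longlonglongrightarrow> q (T \<omega>)" if \<omega>: "\<omega> \<in> space M" for \<omega>
  proof -
    have "(\<lambda>n. T \<omega> + 1 / real (Suc n)) \<longlonglongrightarrow> T \<omega>" by real_asymp
    then have UT: "(\<lambda>n. U n \<omega>) \<longlonglongrightarrow> T \<omega>"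
      by (rule tendsto_sandwich[OF _ _ tendsto_const, rotated 2]) (use U[OF \<omega>] in \<open>auto intro!: always_eventually less_imp_le\<close>)
    show "(\<lambda>n. q (U n \<omega>)) \<longlonglongrightarrow> q (T \<omega>)"
      by (rule continuous_on_tendsto_compose[OF cq UT]) auto
    have "filterlim (\<lambda>n. U n \<omega>) (at_right (T \<omega>)) sequentially"
      using UT U(1)[OF \<omega>] by (auto simp: filterlim_at less_imp_neq[THEN not_sym] intro!: always_eventually)
    moreover have "\<forall>\<^sub>F s in at_right (T \<omega>). N s \<omega> = N (T \<omega>) \<omega>"
      using rc[OF \<omega> T(2)[OF \<omega>]] by (simp add: continuous_within tendsto_discrete)
    ultimately have "\<forall>\<^sub>F n in sequentially. N (U n \<omega>) \<omega> = N (T \<omega>) \<omega>"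
      using eventually_compose_filterlim by blast
    then have "\<forall>\<^sub>F n in sequentially. indicator (A n) \<omega> = I \<omega>"
      by eventually_elim (use \<omega> in \<open>auto simp: A_def I_def\<close>)
    then show "(\<lambda>n. indicator (A n) \<omega>) \<longlonglongrightarrow> I \<omega>" by (rule tendsto_eventually)
  qed
  have mI: "I \<in> borel_measurable M"
    by (rule borel_measurable_LIMSEQ_real[OF lim]) (use A in auto)
  have eqI: "{\<omega> \<in> space M. N (T \<omega>) \<omega> = k} = I -` {1} \<inter> space M" by (auto simp: I_def split: if_splits)
  show sets: "{\<omega> \<in> space M. N (T \<omega>) \<omega> = k} \<in> sets M"
    unfolding eqI using mI by (rule measurable_sets) simp
  have "(\<lambda>n. LINT \<omega>|M. indicator (A n) \<omega>) \<longlonglongrightarrow> (LINT \<omega>|M. I \<omega>)"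
    by (rule integral_dominated_convergence[where w = "\<lambda>_. 1"]) (use lim mI A in \<open>auto intro!: AE_I2\<close>)
  moreover have "(\<lambda>n. LINT \<omega>|M. q (U n \<omega>)) \<longlonglongrightarrow> (LINT \<omega>|M. q (T \<omega>))"
    by (rule integral_dominated_convergence[where w = "\<lambda>_. 1"])
       (use limU mqU in \<open>auto intro!: AE_I2 simp: q01 U0\<close>)
  moreover have "(LINT \<omega>|M. indicator (A n) \<omega>) = (LINT \<omega>|M. q (U n \<omega>))" for n
    using step[of n] A[of n] by simp
  ultimately have "(LINT \<omega>|M. I \<omega>) = (LINT \<omega>|M. q (T \<omega>))"
    using LIMSEQ_unique by simp
  moreover have "(LINT \<omega>|M. I \<omega>) = measure M {\<omega> \<in> space M. N (T \<omega>) \<omega> = k}"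
  proof -
    have "(LINT \<omega>|M. I \<omega>) = (LINT \<omega>|M. indicator {\<omega> \<in> space M. N (T \<omega>) \<omega> = k} \<omega>)"
      by (rule Bochner_Integration.integral_cong) (auto simp: I_def)
    also have "\<dots> = measure M {\<omega> \<in> space M. N (T \<omega>) \<omega> = k}" using sets by simp
    finally show ?thesis .
  qed
  ultimately show "measure M {\<omega> \<in> space M. N (T \<omega>) \<omega> = k} = (LINT \<omega>|M. q (T \<omega>))" by simp
qed

section \<open>The fractional Yule process as a subordinated Yule process\<close>

theorem theorem3p1:
  fixes M :: "'a measure" and M' :: "'b measure"
    and lam \<nu> t :: real
    and X :: "real \<Rightarrow> 'b \<Rightarrow> nat" and N :: "real \<Rightarrow> 'a \<Rightarrow> nat"
    and T :: "'a \<Rightarrow> real" and g :: "real \<Rightarrow> real measure"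
  assumes "lam > 0" and "0 < \<nu>" and "\<nu> \<le> 1" and "t > 0"
    and "fractional_yule_process M' lam \<nu> X"
    and "yule_process M lam N"
    and "cauchy_problem_law (2 * \<nu>) g"
    and "T \<in> borel_measurable M" and "\<forall>\<omega>\<in>space M. 0 \<le> T \<omega>"
    and "distr M borel T = g t"
    and "indep_of_process M T N"
  shows "distr M' (count_space UNIV) (X t) = distr M (count_space UNIV) (\<lambda>\<omega>. N (T \<omega>) \<omega>)"
proof -
  note X = \<open>fractional_yule_process M' lam \<nu> X\<close> and N = \<open>yule_process M lam N\<close> and g = \<open>cauchy_problem_law (2 * \<nu>) g\<close>
  note N' = pure_birth_processD[OF N[unfolded yule_process_def]]
  interpret M: prob_space M by (rule N'(1))
  interpret M': prob_space M' using X by (simp add: fractional_yule_process_def)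
  have mX: "X t \<in> measurable M' (count_space UNIV)" and X1: "\<And>\<omega>. \<omega> \<in> space M' \<Longrightarrow> 1 \<le> X t \<omega>"
    using X \<open>t > 0\<close> unfolding fractional_yule_process_def by auto
  have mN: "N s \<in> measurable M (count_space UNIV)" if "0 \<le> s" for s
    by (rule N'(2)[OF that])
  have rc: "continuous (at_right s) (\<lambda>s. N s \<omega>)" if "\<omega> \<in> space M" "0 \<le> s" for s \<omega>
    by (rule N'(5)[OF that])
  have T0: "0 \<le> T \<omega>" if "\<omega> \<in> space M" for \<omega> using that assms by blast
  have cY: "continuous_on UNIV (yule_prob lam k)" for k
    using has_real_derivative_yule_prob by (auto intro!: continuous_at_imp_continuous_on DERIV_isCont)
  have sub: "{\<omega> \<in> space M. N (T \<omega>) \<omega> = k} \<in> sets M"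
    "measure M {\<omega> \<in> space M. N (T \<omega>) \<omega> = k} = (LINT \<omega>|M. yule_prob lam k (T \<omega>))" if "1 \<le> k" for k
    using subordinated_process_prob[OF M.prob_space_axioms mN rc \<open>T \<in> borel_measurable M\<close> T0
        \<open>indep_of_process M T N\<close> yule_process_prob[OF N _ that] cY] by auto
  have ge1: "1 \<le> N (T \<omega>) \<omega>" if "\<omega> \<in> space M" for \<omega>
    by (rule yule_process_ge_1[OF N T0[OF that] that])
  have mNT: "(\<lambda>\<omega>. N (T \<omega>) \<omega>) \<in> measurable M (count_space UNIV)"
  proof -
    have "(\<lambda>\<omega>. N (T \<omega>) \<omega>) -` {k} \<inter> space M \<in> sets M" for k
    proof -
    have "(\<lambda>\<omega>. N (T \<omega>) \<omega>) -` {k} \<inter> space M = {\<omega> \<in> space M. N (T \<omega>) \<omega> = k}" by auto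
    moreover have "{\<omega> \<in> space M. N (T \<omega>) \<omega> = k} \<in> sets M"
    proof (cases "k = 0")
      case True
      then have "{\<omega> \<in> space M. N (T \<omega>) \<omega> = k} = {}" using ge1 by fastforce
      then show ?thesis by (simp only: sets.empty_sets)
    qed (use sub(1)[of k] in simp)
    ultimately show ?thesis by simp
    qed
    then show ?thesis by (simp add: measurable_count_space_eq2_countable)
  qed
  have eq: "measure M' {\<omega> \<in> space M'. X t \<omega> = k} = measure M {\<omega> \<in> space M. N (T \<omega>) \<omega> = k}" for k
  proof (cases "k = 0")
    case True
    then have "{\<omega> \<in> space M'. X t \<omega> = k} = {}" "{\<omega> \<in> space M. N (T \<omega>) \<omega> = k} = {}"
      using ge1 X1 by fastforce+
    then show ?thesis by (simp only: measure_empty)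
  next
    case False
    then have k: "1 \<le> k" by simp
    have "measure M' {\<omega> \<in> space M'. X t \<omega> = k} = (LINT x|g t. yule_prob lam k x)"
      by (rule fractional_yule_prob_eq[OF _ _ _ X g _ k]) (use assms in auto)
    also have "\<dots> = (LINT \<omega>|M. yule_prob lam k (T \<omega>))"
      using \<open>T \<in> borel_measurable M\<close> borel_measurable_continuous_onI[OF cY[of k]]
      by (simp add: \<open>distr M borel T = g t\<close>[symmetric] integral_distr)
    also have "\<dots> = measure M {\<omega> \<in> space M. N (T \<omega>) \<omega> = k}"
      by (rule sub(2)[OF k, symmetric])
    finally show ?thesis .
  qed
  show ?thesis
  proof (rule measure_eqI_countable[of _ UNIV])
    fix k :: nat
    have "X t -` {k} \<inter> space M' = {\<omega> \<in> space M'. X t \<omega> = k}"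
      "(\<lambda>\<omega>. N (T \<omega>) \<omega>) -` {k} \<inter> space M = {\<omega> \<in> space M. N (T \<omega>) \<omega> = k}" by auto
    then show "emeasure (distr M' (count_space UNIV) (X t)) {k} =
        emeasure (distr M (count_space UNIV) (\<lambda>\<omega>. N (T \<omega>) \<omega>)) {k}"
      using mX mNT eq[of k] by (simp add: emeasure_distr M.emeasure_eq_measure M'.emeasure_eq_measure)
  qed auto
qed

end
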